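(* The problem QBFSAT (deciding whether a QCNF formula is true) is in XP parameterized by the number $k$ of existential variables. In particular, a QCNF formula $\mathcal{Q}.\phi$ with $k$ existential variables, $m$ clauses, and clauses of size at most $d$ can be decided in time $O\big(m^{2^k}\, d\binom{2^k}{2}+2^k|\phi|\big)$.
   Context: A QCNF is a quantified Boolean formula $\mathcal{Q}.\phi$ (prefix $Q_1x_1\dots Q_nx_n$ with $Q_i\in\{\forall,\exists\}$, standard truth semantics over $\{0,1\}$) whose matrix $\phi$ is in CNF; clauses are sets of literals with no repeated or complementary literals, and no clause is repeated. $|\phi|$ is the size of the matrix. A parameterized problem is in XP if it is solvable in time $n^{f(k)}$ for input size $n$, parameter $k$, and a computable $f$. *)

theory Defs
  imports Complex_Main
begin

section \<open>Quantified CNF formulas\<close>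

datatype quantifier = Universal | Existential

datatype literal = Pos nat | Neg nat

text \<open>
  The prefix \<open>Q\<^sub>1 x\<^sub>1 \<dots> Q\<^sub>n x\<^sub>n\<close> is the list of its quantifiers, outermost first;
  a variable is its position in the prefix, counted from 0.
  The matrix is given by a listing of its set of clauses, each clause by a listing of its
  set of literals.
\<close>

datatype qcnf = QCNF (prefix: "quantifier list") (matrix: "literal list list")

fun var :: "literal \<Rightarrow> nat" where
  "var (Pos i) = i"
| "var (Neg i) = i"

text \<open>The condition \<open>distinct (map set \<dots>)\<close> says that no clause, as a set, is repeated.\<close>

definition wf_qcnf :: "qcnf \<Rightarrow> bool" where
  "wf_qcnf \<Phi> \<longleftrightarrow>
     (\<forall>C \<in> set (matrix \<Phi>).
        distinct C \<and>
        (\<forall>i. \<not> (Pos i \<in> set C \<and> Neg i \<in> set C)) \<and>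
        (\<forall>l \<in> set C. var l < length (prefix \<Phi>))) \<and>
     distinct (map set (matrix \<Phi>))"

fun lit_true :: "bool list \<Rightarrow> literal \<Rightarrow> bool" where
  "lit_true \<tau> (Pos i) = \<tau> ! i"
| "lit_true \<tau> (Neg i) = (\<not> \<tau> ! i)"

definition cnf_true :: "bool list \<Rightarrow> literal list list \<Rightarrow> bool" where
  "cnf_true \<tau> M \<longleftrightarrow> (\<forall>C \<in> set M. \<exists>l \<in> set C. lit_true \<tau> l)"

text \<open>\<open>\<tau>\<close> lists the values of the variables whose quantifiers have already been stripped.\<close>

fun qbf_true :: "quantifier list \<Rightarrow> literal list list \<Rightarrow> bool list \<Rightarrow> bool" where
  "qbf_true [] M \<tau> = cnf_true \<tau> M"
| "qbf_true (Universal # Q) M \<tau> = (\<forall>b. qbf_true Q M (\<tau> @ [b]))"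
| "qbf_true (Existential # Q) M \<tau> = (\<exists>b. qbf_true Q M (\<tau> @ [b]))"

definition qcnf_true :: "qcnf \<Rightarrow> bool" where
  "qcnf_true \<Phi> \<longleftrightarrow> qbf_true (prefix \<Phi>) (matrix \<Phi>) []"

definition num_existential :: "qcnf \<Rightarrow> nat" where
  "num_existential \<Phi> = count_list (prefix \<Phi>) Existential"


section \<open>Encoding as a sequence of machine words\<close>

fun enc_quantifier :: "quantifier \<Rightarrow> nat" where
  "enc_quantifier Universal = 0"
| "enc_quantifier Existential = 1"

fun enc_literal :: "literal \<Rightarrow> nat list" where
  "enc_literal (Pos i) = [1, i]"
| "enc_literal (Neg i) = [0, i]"

definition enc_clause :: "literal list \<Rightarrow> nat list" where
  "enc_clause C = length C # concat (map enc_literal C)"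

definition enc_matrix :: "literal list list \<Rightarrow> nat list" where
  "enc_matrix M = length M # concat (map enc_clause M)"

text \<open>
  On well-formed formulas every word of the encoding is smaller than the length of the
  encoding, so measuring inputs in words or in bits differs by a logarithmic factor only.
\<close>

definition enc_qcnf :: "qcnf \<Rightarrow> nat list" where
  "enc_qcnf \<Phi> = length (prefix \<Phi>) # map enc_quantifier (prefix \<Phi>) @ enc_matrix (matrix \<Phi>)"

text \<open>
  The size of the matrix is \<open>1 + m + 2 s\<close> for \<open>m\<close> clauses with \<open>s\<close> literal occurrences in total.
  As at most one clause is empty, this is \<open>O(s + 1)\<close>; in particular it is never 0, so that
  time bounds linear in it leave room for the constant work done even on an empty matrix.
\<close>

definition matrix_size :: "qcnf \<Rightarrow> nat" where
  "matrix_size \<Phi> = length (enc_matrix (matrix \<Phi>))"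


section \<open>Random access machines\<close>

text \<open>
  A RAM in the style of Cook and Reckhow with unit cost per instruction. The only arithmetic
  operations are addition and truncated subtraction; without multiplication or shifts, unit cost
  on unbounded words stays polynomially related to Turing machine time.
  The first argument of \<open>Const\<close>, \<open>Add\<close>, \<open>Sub\<close> and \<open>Load\<close> is the target register;
  \<open>Store r s\<close> writes register \<open>s\<close> to the memory cell whose address is in register \<open>r\<close>;
  \<open>Jump r l\<close> jumps to instruction \<open>l\<close> if register \<open>r\<close> is positive.
\<close>

datatype instr =
    Const nat nat
  | Add nat nat nat
  | Sub nat nat nat
  | Load nat nat
  | Store nat nat
  | Jump nat nat

text \<open>Program counter, registers, memory.\<close>

type_synonym config = "nat \<times> (nat \<Rightarrow> nat) \<times> (nat \<Rightarrow> nat)"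

fun exec :: "instr \<Rightarrow> config \<Rightarrow> config" where
  "exec (Const r c) (pc, R, M) = (Suc pc, R(r := c), M)"
| "exec (Add r s t) (pc, R, M) = (Suc pc, R(r := R s + R t), M)"
| "exec (Sub r s t) (pc, R, M) = (Suc pc, R(r := R s - R t), M)"
| "exec (Load r s) (pc, R, M) = (Suc pc, R(r := M (R s)), M)"
| "exec (Store r s) (pc, R, M) = (Suc pc, R, M(R r := R s))"
| "exec (Jump r l) (pc, R, M) = (if R r > 0 then l else Suc pc, R, M)"

definition halted :: "instr list \<Rightarrow> config \<Rightarrow> bool" where
  "halted P c \<longleftrightarrow> length P \<le> fst c"

definition step :: "instr list \<Rightarrow> config \<Rightarrow> config" where
  "step P c = (if halted P c then c else exec (P ! fst c) c)"

text \<open>The input lies in memory from address 0 on, and register 0 contains its length.\<close>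

definition init :: "nat list \<Rightarrow> config" where
  "init w = (0, (\<lambda>_. 0)(0 := length w), (\<lambda>a. if a < length w then w ! a else 0))"

text \<open>
  On input \<open>w\<close>, program \<open>P\<close> halts after at most \<open>t\<close> steps with \<open>v\<close> in register 0
  (\<open>step\<close> leaves halted configurations unchanged).
\<close>

definition outputs_within :: "instr list \<Rightarrow> nat list \<Rightarrow> nat \<Rightarrow> nat \<Rightarrow> bool" where
  "outputs_within P w t v \<longleftrightarrow>
     (let c = (step P ^^ t) (init w) in halted P c \<and> fst (snd c) 0 = v)"

definition computable :: "(nat \<Rightarrow> nat) \<Rightarrow> bool" where
  "computable f \<longleftrightarrow> (\<exists>P. \<forall>k. \<exists>t. outputs_within P [k] t (f k))"


section \<open>Parameterized problems in XP\<close>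

text \<open>
  A parameterized problem consists of a set \<open>I\<close> of instances, their encoding \<open>enc\<close>,
  the property \<open>yes\<close> to be decided, and the parameter \<open>\<kappa>\<close>.
\<close>

definition in_XP :: "'a set \<Rightarrow> ('a \<Rightarrow> nat list) \<Rightarrow> ('a \<Rightarrow> bool) \<Rightarrow> ('a \<Rightarrow> nat) \<Rightarrow> bool" where
  "in_XP I enc yes \<kappa> \<longleftrightarrow>
     (\<exists>P f. computable f \<and>
       (\<forall>x \<in> I. outputs_within P (enc x) (length (enc x) ^ f (\<kappa> x)) (of_bool (yes x))))"

end

theory Submission
  imports Defs
begin

text \<open>
  A formula is false iff the universal player can answer each of the \<open>2^k\<close> assignments to the
  existential variables with a clause falsified by the resulting play. Such a tuple of clauses comes
  from a strategy iff every clause is falsified by its assignment on the existential variables and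
  any two clauses containing complementary literals of a universal variable \<open>u\<close> belong to assignments
  that differ on an existential variable before \<open>u\<close>. There are \<open>m^(2^k)\<close> tuples, and a pair of
  clauses is checked in time \<open>O(d)\<close> by marking the literals of the first one.

  As the prefix may be much longer than the matrix, the time bound does not allow reading it;
  the algorithm looks up the quantifiers of the variables that occur in the matrix and ignores the
  others, so that it works with some \<open>k' \<le> k\<close> in place of \<open>k\<close>.
\<close>

section \<open>A while language compiled to random access machines\<close>

text \<open>Time O(d) per pair leaves constant time per literal, so whether two assignments differ
  before a given universal variable cannot be found by scanning the existential variables each time.
  The least variable on which they differ is tabulated once for all pairs. With K = 2^k this table
  costs order K^2 k, and no term of the bound is reserved for it: it is paid by m^K \<ge> 2^K, which
  needs m \<ge> 2. Likewise the binomial coefficient pays for the K^2 ordered pairs only if K \<ge>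
  2. Hence the degenerate formulas are settled directly. The machine has no multiplication, and
  clearing arrays indexed by variables would take time of the order of the prefix. So positions are
  advanced by additions, unbounded arrays are interleaved in the memory, and initial zeros stand for
  absent entries. The while language makes running times compositional. Its costs are exact
  instruction counts; the numerals in the time bounds are such counts, rounded up
  generously.\<close>

type_synonym state = "(nat \<Rightarrow> nat) \<times> (nat \<Rightarrow> nat \<Rightarrow> nat)"

datatype expr =
    Num nat
  | Var nat
  | Plus expr expr
  | Minus expr expr
  | Arr nat expr

fun eval :: "expr \<Rightarrow> state \<Rightarrow> nat" where
  "eval (Num c) s = c"
| "eval (Var x) s = fst s x"
| "eval (Plus a b) s = eval a s + eval b s"
| "eval (Minus a b) s = eval a s - eval b s"
| "eval (Arr i a) s = snd s i (eval a s)"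

datatype com =
    Skip
  | Assign nat expr
  | Read nat expr
  | Put nat expr expr
  | Seq com com (infixr ";;" 60)
  | If expr com com
  | While expr com

text \<open>Expressions compile to straight-line code, so one number serves as code length and as
  running time. In an array access, \<open>i + 3\<close> instructions compute the address and one
  loads.\<close>

fun ecost :: "expr \<Rightarrow> nat" where
  "ecost (Num c) = 1"
| "ecost (Var x) = 2"
| "ecost (Plus a b) = ecost a + ecost b + 1"
| "ecost (Minus a b) = ecost a + ecost b + 1"
| "ecost (Arr i a) = ecost a + i + 4"

text \<open>Reading beyond the end of the input \<open>w\<close> is undefined, since the arrays are stored there.\<close>

inductive big :: "nat list \<Rightarrow> com \<Rightarrow> state \<Rightarrow> nat \<Rightarrow> state \<Rightarrow> bool" for w where
  Skip: "big w Skip s 0 s"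
| Assign: "big w (Assign x e) s (ecost e + 2) ((fst s)(x := eval e s), snd s)"
| Read: "eval e s < length w \<Longrightarrow>
    big w (Read x e) s (ecost e + 1) ((fst s)(x := w ! eval e s), snd s)"
| Put: "big w (Put i a e) s (ecost a + ecost e + i + 4)
    (fst s, (snd s)(i := (snd s i)(eval a s := eval e s)))"
| Seq: "big w c s t s' \<Longrightarrow> big w c' s' t' s'' \<Longrightarrow> big w (c ;; c') s (t + t') s''"
| IfT: "eval e s \<noteq> 0 \<Longrightarrow> big w c s t s' \<Longrightarrow> big w (If e c c') s (ecost e + 1 + t) s'"
| IfF: "eval e s = 0 \<Longrightarrow> big w c' s t s' \<Longrightarrow> big w (If e c c') s (ecost e + 2 + t) s'"
| WhileF: "eval e s = 0 \<Longrightarrow> big w (While e c) s (ecost e + 2) s"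
| WhileT: "eval e s \<noteq> 0 \<Longrightarrow> big w c s t s' \<Longrightarrow> big w (While e c) s' t' s'' \<Longrightarrow>
    big w (While e c) s (ecost e + 2 + t + t') s''"

text \<open>
  Variable \<open>x\<close> lives in register \<open>2 x\<close> and the temporary of depth \<open>j\<close> in register \<open>2 j + 5\<close>.
  Register 1 always holds 1, which makes jumps on it unconditional, and register 3 holds the
  length \<open>N\<close> of the input. Cell \<open>a\<close> of array \<open>i\<close> has address \<open>N + 2^i (2 a + 1)\<close>.
\<close>

abbreviation tmp :: "nat \<Rightarrow> nat" where "tmp j \<equiv> 2 * j + 5"

definition addr_code :: "nat \<Rightarrow> nat \<Rightarrow> instr list" where
  "addr_code i r = [Add r r r, Add r r 1] @ replicate i (Add r r r) @ [Add r r 3]"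

fun ecode :: "expr \<Rightarrow> nat \<Rightarrow> instr list" where
  "ecode (Num c) j = [Const (tmp j) c]"
| "ecode (Var x) j = [Const (tmp j) 0, Add (tmp j) (tmp j) (2 * x)]"
| "ecode (Plus a b) j = ecode a j @ ecode b (Suc j) @ [Add (tmp j) (tmp j) (tmp (Suc j))]"
| "ecode (Minus a b) j = ecode a j @ ecode b (Suc j) @ [Sub (tmp j) (tmp j) (tmp (Suc j))]"
| "ecode (Arr i a) j = ecode a j @ addr_code i (tmp j) @ [Load (tmp j) (tmp j)]"

fun ccode :: "com \<Rightarrow> nat \<Rightarrow> instr list" where
  "ccode Skip p = []"
| "ccode (Assign x e) p = ecode e 0 @ [Const (2 * x) 0, Add (2 * x) (2 * x) (tmp 0)]"
| "ccode (Read x e) p = ecode e 0 @ [Load (2 * x) (tmp 0)]"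
| "ccode (Put i a e) p =
     ecode a 0 @ ecode e 1 @ addr_code i (tmp 0) @ [Store (tmp 0) (tmp 1)]"
| "ccode (c ;; c') p = (let C = ccode c p in C @ ccode c' (p + length C))"
| "ccode (If e c c') p =
     (let E = ecode e 0;
          F = ccode c' (p + length E + 1);
          q = p + length E + length F + 2;
          T = ccode c q
      in E @ [Jump (tmp 0) q] @ F @ [Jump 1 (q + length T)] @ T)"
| "ccode (While e c) p =
     (let E = ecode e 0;
          q = p + length E + 2;
          C = ccode c q
      in E @ [Jump (tmp 0) q, Jump 1 (q + length C + 1)] @ C @ [Jump 1 p])"

section \<open>Simulation of the while language by its compiled code, with exact step counts\<close>

definition code_at :: "instr list \<Rightarrow> nat \<Rightarrow> instr list \<Rightarrow> bool" where
  "code_at P p C \<longleftrightarrow> (\<exists>xs ys. P = xs @ C @ ys \<and> length xs = p)"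

lemma code_at_append:
  "code_at P p (C @ D) \<longleftrightarrow> code_at P p C \<and> code_at P (p + length C) D"
proof
  assume "code_at P p (C @ D)"
  then obtain xs ys where P: "P = xs @ (C @ D) @ ys" "length xs = p"
    unfolding code_at_def by blast
  then have "P = xs @ C @ (D @ ys)" "P = (xs @ C) @ D @ ys" "length (xs @ C) = p + length C"
    by simp_all
  with P show "code_at P p C \<and> code_at P (p + length C) D"
    unfolding code_at_def by blast
next
  assume "code_at P p C \<and> code_at P (p + length C) D"
  then obtain xs ys xs' ys' where P: "P = xs @ C @ ys" "length xs = p"
      "P = xs' @ D @ ys'" "length xs' = p + length C"
    unfolding code_at_def by blast
  then have "xs' = xs @ C"
    by (metis append_assoc append_eq_append_conv length_append)
  with P show "code_at P p (C @ D)"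
    unfolding code_at_def by auto
qed

lemma code_at_Cons:
  "code_at P p (i # C) \<longleftrightarrow> p < length P \<and> P ! p = i \<and> code_at P (Suc p) C"
proof -
  have "code_at P p [i] \<longleftrightarrow> p < length P \<and> P ! p = i"
  proof
    assume "p < length P \<and> P ! p = i"
    then have "P = take p P @ [i] @ drop (Suc p) P" "length (take p P) = p"
      by (auto simp: id_take_nth_drop)
    then show "code_at P p [i]" unfolding code_at_def by blast
  qed (auto simp: code_at_def)
  then show ?thesis using code_at_append[of P p "[i]" C] by simp
qed

definition run :: "instr list \<Rightarrow> config \<Rightarrow> nat \<Rightarrow> config \<Rightarrow> bool" where
  "run P c t c' \<longleftrightarrow> (step P ^^ t) c = c'"

lemma run_0: "run P c 0 c" by (simp add: run_def)

lemma run_trans: "run P c t c' \<Longrightarrow> run P c' t' c'' \<Longrightarrow> run P c (t + t') c''"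
  unfolding run_def by (subst add.commute) (simp add: funpow_add)

lemma run_step: "p < length P \<Longrightarrow> P ! p = i \<Longrightarrow> run P (p, R, M) 1 (exec i (p, R, M))"
  by (simp add: run_def step_def halted_def)

lemma run_Cons:
  "code_at P p (i # C) \<Longrightarrow> exec i (p, R, M) = c \<Longrightarrow> run P c t c' \<Longrightarrow>
   run P (p, R, M) (Suc t) c'"
  using run_trans[OF run_step, of p P i R M] by (simp add: code_at_Cons)

definition cell :: "nat \<Rightarrow> nat \<Rightarrow> nat" where
  "cell i a = 2 ^ i * (2 * a + 1)"

text \<open>Uniqueness of writing a positive number as a power of two times an odd number. So arrays
  of unbounded length share the memory without overlap, and their addresses need only
  additions.\<close>

lemma cell_inj: "cell i a = cell j b \<longleftrightarrow> i = j \<and> a = b"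
proof (induction i arbitrary: j)
  case 0
  show ?case by (cases j) (auto simp: cell_def, presburger)
next
  case (Suc i)
  show ?case
  proof (cases j)
    case 0
    then show ?thesis by (auto simp: cell_def, presburger)
  next
    case (Suc j')
    moreover have "cell (Suc i) a = 2 * cell i a" "cell (Suc j') b = 2 * cell j' b"
      by (simp_all add: cell_def)
    ultimately show ?thesis using Suc.IH[of j'] by simp
  qed
qed

text \<open>The odd registers from 5 on stay unconstrained, so that writing a temporary never breaks
  the relation. The input has to survive, since the clauses are read from it again for every
  tuple.\<close>

definition rel :: "nat list \<Rightarrow> state \<Rightarrow> (nat \<Rightarrow> nat) \<Rightarrow> (nat \<Rightarrow> nat) \<Rightarrow> bool" where
  "rel w s R M \<longleftrightarrow>
     (\<forall>x. R (2 * x) = fst s x) \<and> R 1 = 1 \<and> R 3 = length w \<and>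
     (\<forall>a < length w. M a = w ! a) \<and> (\<forall>i a. M (length w + cell i a) = snd s i a)"

lemma rel_tmp: "rel w s R M \<Longrightarrow> rel w s (R(tmp j := v)) M"
  unfolding rel_def by (auto, presburger)

lemma run_doubling:
  "code_at P p (replicate i (Add r r r)) \<Longrightarrow>
   run P (p, R, M) i (p + i, R(r := 2 ^ i * R r), M)"
proof (induction i arbitrary: p R)
  case 0
  then show ?case by (simp add: run_0)
next
  case (Suc i)
  let ?R = "R(r := R r + R r)"
  have "run P (Suc p, ?R, M) i (Suc p + i, ?R(r := 2 ^ i * ?R r), M)"
    by (rule Suc.IH) (use Suc.prems in \<open>simp add: code_at_Cons\<close>)
  then have "run P (Suc p, ?R, M) i (Suc p + i, R(r := 2 ^ i * (2 * R r)), M)"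
    by (simp add: mult_2)
  from run_Cons[OF _ _ this, of p "Add r r r" "replicate i (Add r r r)" R M] Suc.prems
  have "run P (p, R, M) (Suc i) (p + Suc i, R(r := 2 ^ Suc i * R r), M)"
    by (simp add: mult.left_commute mult.assoc)
  then show ?case .
qed

lemma length_addr_code [simp]: "length (addr_code i r) = i + 3"
  by (simp add: addr_code_def)

lemma run_addr:
  assumes "code_at P p (addr_code i (tmp j))" "R (Suc 0) = Suc 0" "R 3 = N"
  shows "run P (p, R, M) (i + 3) (p + i + 3, R(tmp j := N + cell i (R (tmp j))), M)"
proof -
  let ?r = "tmp j"
  let ?R = "R(?r := 2 * R ?r + 1)"
  have 1: "run P (p, R, M) (Suc (Suc 0)) (Suc (Suc p), ?R, M)"
    using assms
    by (auto simp: run_def step_def halted_def code_at_Cons addr_code_def)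
  have 2: "run P (Suc (Suc p), ?R, M) i (Suc (Suc p) + i, ?R(?r := 2 ^ i * ?R ?r), M)"
    using assms by (intro run_doubling) (simp add: code_at_Cons code_at_append addr_code_def)
  have 3: "run P (Suc (Suc p) + i, ?R(?r := 2 ^ i * ?R ?r), M) 1
      (p + i + 3, R(?r := N + cell i (R ?r)), M)"
    using assms
    by (auto simp: run_def step_def halted_def code_at_Cons code_at_append cell_def
        addr_code_def)
  have "Suc (Suc 0) + i + 1 = i + 3" by simp
  then show ?thesis using run_trans[OF run_trans[OF 1 2] 3] by metis
qed

lemma length_ecode [simp]: "length (ecode e j) = ecost e"
  by (induction e arbitrary: j) auto

text \<open>The claim about the temporaries below \<open>j\<close> carries the induction: the value
  of a left operand waits in \<open>tmp j\<close> while the right operand is evaluated at depth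
  \<open>Suc j\<close>.\<close>

lemma run_ecode:
  assumes "code_at P p (ecode e j)" "rel w s R M"
  shows "\<exists>R'. run P (p, R, M) (ecost e) (p + ecost e, R', M) \<and> rel w s R' M \<and>
    R' (tmp j) = eval e s \<and> (\<forall>i < j. R' (tmp i) = R (tmp i))"
  using assms
proof (induction e arbitrary: j p R)
  case (Num c)
  define R' where "R' = R(tmp j := c)"
  have R'_tmp: "R' (tmp j) = c" "\<And>i. i < j \<Longrightarrow> R' (tmp i) = R (tmp i)"
    by (auto simp: R'_def)
  have "run P (p, R, M) 1 (p + 1, R', M)"
    using Num.prems by (auto simp: run_def step_def halted_def R'_def code_at_Cons)
  then show ?case using rel_tmp[OF Num.prems(2), of j c, folded R'_def]
    by (intro exI[of _ R']) (auto simp: R'_tmp)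
next
  case (Var x)
  define R' where "R' = R(tmp j := R (2 * x))"
  have R'_tmp: "R' (tmp j) = R (2 * x)" "\<And>i. i < j \<Longrightarrow> R' (tmp i) = R (tmp i)"
    by (auto simp: R'_def)
  have "2 * x \<noteq> tmp j" by presburger
  then have "run P (p, R, M) 2 (p + 2, R', M)"
    using Var.prems unfolding numeral_2_eq_2
    by (auto simp: run_def step_def halted_def R'_def code_at_Cons)
  moreover have "R (2 * x) = fst s x" using Var.prems by (simp add: rel_def)
  ultimately show ?case using rel_tmp[OF Var.prems(2), of j "R (2 * x)", folded R'_def]
    by (intro exI[of _ R']) (auto simp: R'_tmp)
next
  case (Plus a b)
  then obtain R1 where 1: "run P (p, R, M) (ecost a) (p + ecost a, R1, M)" "rel w s R1 M"
      "R1 (tmp j) = eval a s" "\<forall>i < j. R1 (tmp i) = R (tmp i)"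
    by (auto simp: code_at_append) blast
  obtain R2 where 2: "run P (p + ecost a, R1, M) (ecost b) (p + ecost a + ecost b, R2, M)"
      "rel w s R2 M" "R2 (tmp (Suc j)) = eval b s" "\<forall>i < Suc j. R2 (tmp i) = R1 (tmp i)"
    using Plus.IH(2)[of "p + ecost a" "Suc j" R1] Plus.prems 1 by (auto simp: code_at_append)
  define R' where "R' = R2(tmp j := eval a s + eval b s)"
  have R'_tmp: "R' (tmp j) = eval a s + eval b s" "\<And>i. i < j \<Longrightarrow> R' (tmp i) = R2 (tmp i)"
    by (auto simp: R'_def)
  have 3: "run P (p + ecost a + ecost b, R2, M) 1 (p + ecost a + ecost b + 1, R', M)"
    using Plus.prems 1 2
    by (auto simp: run_def step_def halted_def R'_def code_at_Cons code_at_append add.assoc)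
  show ?case using run_trans[OF run_trans[OF 1(1) 2(1)] 3] 1 2 rel_tmp[OF 2(2), of j "eval a s + eval b s", folded R'_def]
    by (intro exI[of _ R']) (auto simp: R'_tmp add.assoc)
next
  case (Minus a b)
  then obtain R1 where 1: "run P (p, R, M) (ecost a) (p + ecost a, R1, M)" "rel w s R1 M"
      "R1 (tmp j) = eval a s" "\<forall>i < j. R1 (tmp i) = R (tmp i)"
    by (auto simp: code_at_append) blast
  obtain R2 where 2: "run P (p + ecost a, R1, M) (ecost b) (p + ecost a + ecost b, R2, M)"
      "rel w s R2 M" "R2 (tmp (Suc j)) = eval b s" "\<forall>i < Suc j. R2 (tmp i) = R1 (tmp i)"
    using Minus.IH(2)[of "p + ecost a" "Suc j" R1] Minus.prems 1 by (auto simp: code_at_append)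
  define R' where "R' = R2(tmp j := eval a s - eval b s)"
  have R'_tmp: "R' (tmp j) = eval a s - eval b s" "\<And>i. i < j \<Longrightarrow> R' (tmp i) = R2 (tmp i)"
    by (auto simp: R'_def)
  have 3: "run P (p + ecost a + ecost b, R2, M) 1 (p + ecost a + ecost b + 1, R', M)"
    using Minus.prems 1 2
    by (auto simp: run_def step_def halted_def R'_def code_at_Cons code_at_append add.assoc)
  show ?case using run_trans[OF run_trans[OF 1(1) 2(1)] 3] 1 2 rel_tmp[OF 2(2), of j "eval a s - eval b s", folded R'_def]
    by (intro exI[of _ R']) (auto simp: R'_tmp add.assoc)
next
  case (Arr i a)
  then obtain R1 where 1: "run P (p, R, M) (ecost a) (p + ecost a, R1, M)" "rel w s R1 M"
      "R1 (tmp j) = eval a s" "\<forall>i < j. R1 (tmp i) = R (tmp i)"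
    by (auto simp: code_at_append) blast
  let ?a = "length w + cell i (eval a s)"
  have 2: "run P (p + ecost a, R1, M) (i + 3) (p + ecost a + i + 3, R1(tmp j := ?a), M)"
    using run_addr[of P "p + ecost a" i j R1 "length w" M] Arr.prems 1
    by (simp add: code_at_append rel_def)
  define R' where "R' = R1(tmp j := snd s i (eval a s))"
  have R'_tmp: "R' (tmp j) = snd s i (eval a s)" "\<And>i. i < j \<Longrightarrow> R' (tmp i) = R1 (tmp i)"
    by (auto simp: R'_def)
  have 3: "run P (p + ecost a + i + 3, R1(tmp j := ?a), M) 1 (p + ecost a + i + 4, R', M)"
    using Arr.prems 1
    by (auto simp: run_def step_def halted_def R'_def code_at_Cons code_at_append add.assoc rel_def
        eval_nat_numeral)
    have "ecost a + (i + 3) + 1 = ecost a + i + 4" by simp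
  then have "run P (p, R, M) (ecost a + i + 4) (p + ecost a + i + 4, R', M)"
    using run_trans[OF run_trans[OF 1(1) 2] 3] by metis
  then show ?case
    using 1 rel_tmp[OF 1(2), of j "snd s i (eval a s)", folded R'_def]
    by (intro exI[of _ R']) (auto simp: R'_tmp add.assoc)
qed

lemma run_jump:
  assumes "p < length P" "P ! p = Jump r q"
  shows "run P (p, R, M) 1 (if R r > 0 then q else Suc p, R, M)"
  using run_step[OF assms, of R M] by simp

lemma rel_one: "rel w s R M \<Longrightarrow> R (Suc 0) = Suc 0"
  by (simp add: rel_def)

lemma rel_assign: "rel w s R M \<Longrightarrow> rel w ((fst s)(x := v), snd s) (R(2 * x := v)) M"
proof -
  have "2 * x \<noteq> 1" "2 * x \<noteq> 3" by presburger+
  then show "rel w s R M \<Longrightarrow> ?thesis" by (auto simp: rel_def)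
qed

lemma rel_put:
  "rel w s R M \<Longrightarrow>
   rel w (fst s, (snd s)(i := (snd s i)(a := v))) R (M(length w + cell i a := v))"
  unfolding rel_def by (auto simp: cell_inj)

text \<open>Induction on the derivation, not on the command: after the jump back, the remaining
  iterations of a loop form a smaller derivation for the same code at the same position. Jump
  targets are absolute, so \<open>p\<close> is both the place of the code and the place it is
  generated for.\<close>

lemma run_ccode:
  assumes "big w c s t s'" "code_at P p (ccode c p)" "rel w s R M"
  shows "\<exists>R' M'. run P (p, R, M) t (p + length (ccode c p), R', M') \<and> rel w s' R' M'"
  using assms
proof (induction arbitrary: p R M rule: big.induct)
  case (Skip s)
  then show ?case by (auto intro: run_0)
next
  case (Assign x e s)
  obtain R1 where 1: "run P (p, R, M) (ecost e) (p + ecost e, R1, M)" "rel w s R1 M"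
      "R1 (tmp 0) = eval e s"
    using run_ecode[of P p e 0 w s R M] Assign.prems by (auto simp: code_at_append)
  have "2 * x \<noteq> 5" by presburger
  then have "run P (p + ecost e, R1, M) 2 (p + ecost e + 2, R1(2 * x := eval e s), M)"
    unfolding numeral_2_eq_2 using Assign.prems 1
    by (auto simp: run_def step_def halted_def code_at_Cons code_at_append)
  from run_trans[OF 1(1) this] rel_assign[OF 1(2), of x "eval e s"] show ?case by auto
next
  case (Read e s x)
  obtain R1 where 1: "run P (p, R, M) (ecost e) (p + ecost e, R1, M)" "rel w s R1 M"
      "R1 (tmp 0) = eval e s"
    using run_ecode[of P p e 0 w s R M] Read.prems by (auto simp: code_at_append)
  have "run P (p + ecost e, R1, M) 1 (p + ecost e + 1, R1(2 * x := w ! eval e s), M)"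
    using Read 1
    by (auto simp: run_def step_def halted_def code_at_Cons code_at_append rel_def)
  from run_trans[OF 1(1) this] rel_assign[OF 1(2), of x "w ! eval e s"] show ?case by auto
next
  case (Put i a e s)
  obtain R1 where 1: "run P (p, R, M) (ecost a) (p + ecost a, R1, M)" "rel w s R1 M"
      "R1 (tmp 0) = eval a s"
    using run_ecode[of P p a 0 w s R M] Put.prems
    by (auto simp: code_at_append)
  obtain R2 where 2: "run P (p + ecost a, R1, M) (ecost e) (p + ecost a + ecost e, R2, M)"
      "rel w s R2 M" "R2 (tmp 0) = eval a s" "R2 (tmp 1) = eval e s"
    using run_ecode[of P "p + ecost a" e 1 w s R1 M] Put.prems 1
    by (auto simp: code_at_append)
  let ?a = "length w + cell i (eval a s)"
  let ?p = "p + ecost a + ecost e"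
  have 3: "run P (?p, R2, M) (i + 3) (?p + i + 3, R2(tmp 0 := ?a), M)"
    using run_addr[of P ?p i 0 R2 "length w" M, OF _ rel_one[OF 2(2)]] Put.prems 2
    by (simp add: code_at_append rel_def add.assoc)
  have 4: "run P (?p + i + 3, R2(tmp 0 := ?a), M) 1
      (?p + i + 4, R2(tmp 0 := ?a), M(?a := eval e s))"
    using Put.prems 2
    by (auto simp: run_def step_def halted_def code_at_Cons code_at_append add.assoc
        eval_nat_numeral)
  have t: "ecost a + ecost e + (i + 3) + 1 = ecost a + ecost e + i + 4" by simp
  have p: "p + ecost a + ecost e + i + 4 = p + length (ccode (Put i a e) p)" by simp
  show ?case
    using run_trans[OF run_trans[OF run_trans[OF 1(1) 2(1)] 3] 4]
      rel_put[OF rel_tmp[OF 2(2), of 0 ?a], of i "eval a s" "eval e s"]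
    unfolding t p by blast
next
  case (Seq c s t s' c' t' s'')
  let ?C = "ccode c p"
  obtain R1 M1 where 1: "run P (p, R, M) t (p + length ?C, R1, M1)" "rel w s' R1 M1"
    using Seq.IH(1)[of p R M] Seq.prems by (auto simp: code_at_append Let_def)
  obtain R2 M2 where 2: "run P (p + length ?C, R1, M1) t'
      (p + length ?C + length (ccode c' (p + length ?C)), R2, M2)" "rel w s'' R2 M2"
    using Seq.IH(2)[of "p + length ?C" R1 M1] Seq.prems 1 by (auto simp: code_at_append Let_def)
  show ?case using run_trans[OF 1(1) 2(1)] 2 by (auto simp: Let_def add.assoc)
next
  case (IfT e s c t s' c')
  let ?F = "ccode c' (p + ecost e + 1)"
  let ?q = "p + ecost e + length ?F + 2"
  obtain R1 where 1: "run P (p, R, M) (ecost e) (p + ecost e, R1, M)" "rel w s R1 M"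
      "R1 (tmp 0) = eval e s"
    using run_ecode[of P p e 0 w s R M] IfT.prems by (auto simp: code_at_append Let_def)
  have 2: "run P (p + ecost e, R1, M) 1 (?q, R1, M)"
    using run_jump[of "p + ecost e" P "tmp 0" ?q R1 M] IfT 1
    by (auto simp: code_at_append code_at_Cons Let_def)
  obtain R2 M2 where 3: "run P (?q, R1, M) t (?q + length (ccode c ?q), R2, M2)" "rel w s' R2 M2"
    using IfT.IH[of ?q R1 M] IfT.prems 1
    by (auto simp: code_at_append code_at_Cons Let_def add.assoc)
  show ?case using run_trans[OF run_trans[OF 1(1) 2] 3(1)] 3
    by (auto simp: Let_def add.assoc)
next
  case (IfF e s c' t s' c)
  let ?F = "ccode c' (p + ecost e + 1)"
  let ?q = "p + ecost e + length ?F + 2"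
  let ?z = "?q + length (ccode c ?q)"
  obtain R1 where 1: "run P (p, R, M) (ecost e) (p + ecost e, R1, M)" "rel w s R1 M"
      "R1 (tmp 0) = eval e s"
    using run_ecode[of P p e 0 w s R M] IfF.prems by (auto simp: code_at_append Let_def)
  have 2: "run P (p + ecost e, R1, M) 1 (p + ecost e + 1, R1, M)"
    using run_jump[of "p + ecost e" P "tmp 0" ?q R1 M] IfF 1
    by (auto simp: code_at_append code_at_Cons Let_def)
  obtain R2 M2 where 3: "run P (p + ecost e + 1, R1, M) t (p + ecost e + 1 + length ?F, R2, M2)"
      "rel w s' R2 M2"
    using IfF.IH[of "p + ecost e + 1" R1 M] IfF.prems 1
    by (auto simp: code_at_append code_at_Cons Let_def add.assoc)
  have 4: "run P (p + ecost e + 1 + length ?F, R2, M2) 1 (?z, R2, M2)"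
    using run_jump[of "p + ecost e + 1 + length ?F" P 1 ?z R2 M2] IfF.prems rel_one[OF 3(2)]
    by (auto simp: code_at_append code_at_Cons Let_def add.assoc)
  show ?case using run_trans[OF run_trans[OF run_trans[OF 1(1) 2] 3(1)] 4] 3
    by (auto simp: Let_def add.assoc add.left_commute)
next
  case (WhileF e s c)
  let ?q = "p + ecost e + 2"
  let ?z = "?q + length (ccode c ?q) + 1"
  obtain R1 where 1: "run P (p, R, M) (ecost e) (p + ecost e, R1, M)" "rel w s R1 M"
      "R1 (tmp 0) = eval e s"
    using run_ecode[of P p e 0 w s R M] WhileF.prems by (auto simp: code_at_append Let_def)
  have 2: "run P (p + ecost e, R1, M) 1 (p + ecost e + 1, R1, M)"
    using run_jump[of "p + ecost e" P "tmp 0" ?q R1 M] WhileF 1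
    by (auto simp: code_at_append code_at_Cons Let_def)
  have 3: "run P (p + ecost e + 1, R1, M) 1 (?z, R1, M)"
    using run_jump[of "p + ecost e + 1" P 1 ?z R1 M] WhileF.prems rel_one[OF 1(2)]
    by (auto simp: code_at_append code_at_Cons Let_def add.assoc)
  show ?case using run_trans[OF run_trans[OF 1(1) 2] 3] 1
    by (auto simp: Let_def add.assoc eval_nat_numeral)
next
  case (WhileT e s c t s' t' s'')
  let ?q = "p + ecost e + 2"
  let ?C = "ccode c ?q"
  obtain R1 where 1: "run P (p, R, M) (ecost e) (p + ecost e, R1, M)" "rel w s R1 M"
      "R1 (tmp 0) = eval e s"
    using run_ecode[of P p e 0 w s R M] WhileT.prems by (auto simp: code_at_append Let_def)
  have 2: "run P (p + ecost e, R1, M) 1 (?q, R1, M)"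
    using run_jump[of "p + ecost e" P "tmp 0" ?q R1 M] WhileT 1
    by (auto simp: code_at_append code_at_Cons Let_def)
  obtain R2 M2 where 3: "run P (?q, R1, M) t (?q + length ?C, R2, M2)" "rel w s' R2 M2"
    using WhileT.IH(1)[of ?q R1 M] WhileT.prems 1
    by (auto simp: code_at_append code_at_Cons Let_def add.assoc)
  have 4: "run P (?q + length ?C, R2, M2) 1 (p, R2, M2)"
    using run_jump[of "?q + length ?C" P 1 p R2 M2] WhileT.prems rel_one[OF 3(2)]
    by (auto simp: code_at_append code_at_Cons Let_def add.assoc)
  obtain R3 M3 where 5: "run P (p, R2, M2) t' (p + length (ccode (While e c) p), R3, M3)"
      "rel w s'' R3 M3"
    using WhileT.IH(2)[OF WhileT.prems(1) 3(2)] by blast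
  show ?case using run_trans[OF run_trans[OF run_trans[OF run_trans[OF 1(1) 2] 3(1)] 4] 5(1)] 5
    by (auto simp add: add.assoc)
qed

text \<open>Register 3 is initially 0, so the addition copies the input length out of register 0,
  which is variable 0 and later receives the answer. The offset 2 here and the \<open>t + 2\<close>
  in time bounds account for this prologue.\<close>

definition compile :: "com \<Rightarrow> instr list" where
  "compile c = [Const 1 1, Add 3 0 3] @ ccode c 2"

lemma run_halted: "run P c t c' \<Longrightarrow> halted P c' \<Longrightarrow> t \<le> u \<Longrightarrow> run P c u c'"
proof -
  assume a: "run P c t c'" "halted P c'" "t \<le> u"
  have "(step P ^^ d) c' = c'" for d
    by (induction d) (use a in \<open>auto simp: step_def\<close>)
  then have "run P c' (u - t) c'" by (simp add: run_def)
  from run_trans[OF a(1) this] a show ?thesis by simp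
qed

definition start :: "nat list \<Rightarrow> state" where
  "start w = ((\<lambda>_. 0)(0 := length w), \<lambda>_ _. 0)"

lemma outputs_within_compile:
  assumes "big w c (start w) t s'" "t + 2 \<le> u"
  shows "outputs_within (compile c) w u (fst s' 0)"
proof -
  let ?P = "compile c"
  obtain p R M where init: "init w = (p, R, M)" by (metis prod_cases3)
  let ?R = "R(1 := 1, 3 := length w)"
  have "run ?P (init w) 2 (2, ?R, M)"
    using init by (auto simp: run_def step_def halted_def compile_def init_def numeral_2_eq_2)
  moreover have "rel w (start w) ?R M"
    using init by (auto simp: rel_def init_def start_def cell_def, presburger+)
  then obtain R' M' where "run ?P (2, ?R, M) t (2 + length (ccode c 2), R', M')" "rel w s' R' M'"
    using run_ccode[OF assms(1), of ?P 2 ?R M]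
    by (auto simp: compile_def code_at_def) (metis length_Cons list.size(3) One_nat_def Suc_1 append.right_neutral append_Cons append_Nil)
  ultimately have "run ?P (init w) (2 + t) (2 + length (ccode c 2), R', M')" "R' 0 = fst s' 0"
    using run_trans by (blast, simp add: rel_def, metis mult_0_right)
  moreover have "halted ?P (2 + length (ccode c 2), R', M')"
    by (simp add: halted_def compile_def)
  ultimately have "run ?P (init w) u (2 + length (ccode c 2), R', M')"
    using assms(2) by (auto intro: run_halted)
  then show ?thesis
    using \<open>R' 0 = fst s' 0\<close> \<open>halted ?P _\<close> by (simp add: outputs_within_def run_def Let_def)
qed

section \<open>Refuting a formula by a tuple of clauses\<close>

text \<open>The value of the variable under which the literal is true; also the first word of its
  encoding.\<close>

fun sgnl :: "literal \<Rightarrow> nat" where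
  "sgnl (Pos i) = 1"
| "sgnl (Neg i) = 0"

definition existential :: "qcnf \<Rightarrow> nat \<Rightarrow> bool" where
  "existential \<Phi> v \<longleftrightarrow> v < length (prefix \<Phi>) \<and> prefix \<Phi> ! v = Existential"

lemma lit_true_iff: "lit_true \<tau> l \<longleftrightarrow> sgnl l = of_bool (\<tau> ! var l)"
  by (cases l) auto

text \<open>A universal strategy, continuing the play \<tau>, of which only the clause falsified in
  the end by each existential play \<sigma> is recorded. The universal moves are implicit, as the
  values that falsify universal literals. They can be made without foresight iff two plays requiring
  opposite values have diverged before, which is the last condition.\<close>

definition refutation :: "qcnf \<Rightarrow> bool list \<Rightarrow> ((nat \<Rightarrow> bool) \<Rightarrow> literal list) \<Rightarrow> bool" where
  "refutation \<Phi> \<tau> c \<longleftrightarrow>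
     (\<forall>\<sigma>. c \<sigma> \<in> set (matrix \<Phi>)) \<and>
     (\<forall>\<sigma>. \<forall>l \<in> set (c \<sigma>). var l < length \<tau> \<longrightarrow> sgnl l \<noteq> of_bool (\<tau> ! var l)) \<and>
     (\<forall>\<sigma>. \<forall>l \<in> set (c \<sigma>). length \<tau> \<le> var l \<longrightarrow> existential \<Phi> (var l) \<longrightarrow>
        sgnl l \<noteq> of_bool (\<sigma> (var l))) \<and>
     (\<forall>\<sigma> \<sigma>'. \<forall>l \<in> set (c \<sigma>). \<forall>l' \<in> set (c \<sigma>').
        length \<tau> \<le> var l \<longrightarrow> \<not> existential \<Phi> (var l) \<longrightarrow> var l' = var l \<longrightarrow> sgnl l' \<noteq> sgnl l \<longrightarrow>
        (\<exists>e < var l. length \<tau> \<le> e \<and> existential \<Phi> e \<and> \<sigma> e \<noteq> \<sigma>' e))"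

lemma
  assumes "refutation \<Phi> \<tau> c"
  shows refutation_clause: "c \<sigma> \<in> set (matrix \<Phi>)"
    and refutation_assigned:
      "l \<in> set (c \<sigma>) \<Longrightarrow> var l < length \<tau> \<Longrightarrow> sgnl l \<noteq> of_bool (\<tau> ! var l)"
    and refutation_existential:
      "l \<in> set (c \<sigma>) \<Longrightarrow> length \<tau> \<le> var l \<Longrightarrow> existential \<Phi> (var l) \<Longrightarrow>
       sgnl l \<noteq> of_bool (\<sigma> (var l))"
    and refutation_universal:
      "l \<in> set (c \<sigma>) \<Longrightarrow> l' \<in> set (c \<sigma>') \<Longrightarrow> length \<tau> \<le> var l \<Longrightarrow>
       \<not> existential \<Phi> (var l) \<Longrightarrow> var l' = var l \<Longrightarrow> sgnl l' \<noteq> sgnl l \<Longrightarrow>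
       \<exists>e < var l. length \<tau> \<le> e \<and> existential \<Phi> e \<and> \<sigma> e \<noteq> \<sigma>' e"
  using assms unfolding refutation_def by blast+

lemma sgnl_cases: "sgnl l = 0 \<or> sgnl l = 1"
  by (cases l) auto

text \<open>Induction along the prefix. A universal variable in front cannot occur with both signs
  in the chosen clauses, so one move falsifies all its literals. For an existential one, a strategy
  restricts to the plays with a given first move, and strategies for the two moves are glued by
  distinguishing that move.\<close>

lemma qbf_false_iff_refutation:
  assumes "\<And>C l. C \<in> set (matrix \<Phi>) \<Longrightarrow> l \<in> set C \<Longrightarrow> var l < length (prefix \<Phi>)"
  assumes "length \<tau> \<le> length (prefix \<Phi>)" "Q = drop (length \<tau>) (prefix \<Phi>)"
  shows "\<not> qbf_true Q (matrix \<Phi>) \<tau> \<longleftrightarrow> (\<exists>c. refutation \<Phi> \<tau> c)"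
  using assms(2,3)
proof (induction Q arbitrary: \<tau>)
  case Nil
  then have len: "length \<tau> = length (prefix \<Phi>)" by simp
  show ?case
  proof
    assume "\<not> qbf_true [] (matrix \<Phi>) \<tau>"
    then obtain C where "C \<in> set (matrix \<Phi>)" "\<forall>l \<in> set C. \<not> lit_true \<tau> l"
      by (auto simp: cnf_true_def)
    then have "refutation \<Phi> \<tau> (\<lambda>_. C)"
      using assms(1) len by (force simp: refutation_def lit_true_iff)
    then show "\<exists>c. refutation \<Phi> \<tau> c" by blast
  next
    assume "\<exists>c. refutation \<Phi> \<tau> c"
    then obtain c where "refutation \<Phi> \<tau> c" by blast
    note c = this
    \<comment> \<open>All variables are assigned, so any play serves as the argument of
      \<open>c\<close>.\<close>
    have "\<forall>l \<in> set (c (\<lambda>_. False)). \<not> lit_true \<tau> l"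
      using refutation_assigned[OF c] assms(1)[OF refutation_clause[OF c]] len
      by (simp add: lit_true_iff)
    with refutation_clause[OF c] show "\<not> qbf_true [] (matrix \<Phi>) \<tau>" by (auto simp: cnf_true_def)
  qed
next
  case (Cons q Q)
  let ?i = "length \<tau>"
  have i: "?i < length (prefix \<Phi>)" and q: "prefix \<Phi> ! ?i = q"
      and Q: "Q = drop (Suc ?i) (prefix \<Phi>)"
    using Cons.prems
    by (metis drop_all leI list.distinct(1), metis hd_drop_conv_nth drop_all leI list.distinct(1) list.sel(1),
        metis drop_Suc list.sel(3) tl_drop)
  have IH: "\<not> qbf_true Q (matrix \<Phi>) (\<tau> @ [b]) \<longleftrightarrow> (\<exists>c. refutation \<Phi> (\<tau> @ [b]) c)" for b
    using Cons.IH[of "\<tau> @ [b]"] i Q by simp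
  show ?case
  proof (cases q)
    case Universal
    then have nex: "\<not> existential \<Phi> ?i" using q by (simp add: existential_def)
    have "\<exists>b. refutation \<Phi> (\<tau> @ [b]) c" if c: "refutation \<Phi> \<tau> c" for c
    proof -
      \<comment> \<open>An opposite pair would require a diverging existential variable at or after
        position \<open>?i\<close> but before \<open>?i\<close>.\<close>
      have same: "sgnl l = sgnl l'" if "l \<in> set (c \<sigma>)" "l' \<in> set (c \<sigma>')" "var l = ?i" "var l' = ?i"
        for l l' \<sigma> \<sigma>'
        using refutation_universal[OF c that(2,1)] that nex by (metis leD order_refl)
      obtain b where b: "\<forall>\<sigma>. \<forall>l \<in> set (c \<sigma>). var l = ?i \<longrightarrow> sgnl l \<noteq> of_bool b"
      proof (cases "\<exists>\<sigma>. \<exists>l \<in> set (c \<sigma>). var l = ?i")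
        case True
        then obtain \<sigma> l where l: "l \<in> set (c \<sigma>)" "var l = ?i" by blast
        have "sgnl l \<noteq> of_bool (sgnl l = 0)" using sgnl_cases[of l] by auto
        then show ?thesis using same[OF l(1) _ l(2)] by (intro that[of "sgnl l = 0"]) metis
      qed (use that in blast)
      have "refutation \<Phi> (\<tau> @ [b]) c"
        unfolding refutation_def
      proof (intro conjI allI ballI impI)
        fix \<sigma> l assume l: "l \<in> set (c \<sigma>)" "var l < length (\<tau> @ [b])"
        show "sgnl l \<noteq> of_bool ((\<tau> @ [b]) ! var l)"
          using b l refutation_assigned[OF c l(1)] by (cases "var l = ?i") (auto simp: nth_append)
      next
        fix \<sigma> \<sigma>' l l'
        assume l: "l \<in> set (c \<sigma>)" "l' \<in> set (c \<sigma>')" "length (\<tau> @ [b]) \<le> var l"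
          "\<not> existential \<Phi> (var l)" "var l' = var l" "sgnl l' \<noteq> sgnl l"
        then obtain e where "e < var l" "?i \<le> e" "existential \<Phi> e" "\<sigma> e \<noteq> \<sigma>' e"
          using refutation_universal[OF c l(1,2)] by auto
        moreover from this have "e \<noteq> ?i" using nex by blast
        ultimately show "\<exists>e < var l. length (\<tau> @ [b]) \<le> e \<and> existential \<Phi> e \<and> \<sigma> e \<noteq> \<sigma>' e"
          by (intro exI[of _ e]) auto
      qed (use refutation_clause[OF c] refutation_existential[OF c] in auto)
      then show ?thesis by blast
    qed
    moreover have "refutation \<Phi> \<tau> c" if c: "refutation \<Phi> (\<tau> @ [b]) c" for b c
      unfolding refutation_def
    proof (intro conjI allI ballI impI)
      fix \<sigma> l assume l: "l \<in> set (c \<sigma>)" "var l < ?i"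
      then have "sgnl l \<noteq> of_bool ((\<tau> @ [b]) ! var l)"
        using refutation_assigned[OF c l(1)] by simp
      then show "sgnl l \<noteq> of_bool (\<tau> ! var l)" using l by (simp add: nth_append)
    next
      fix \<sigma> l assume l: "l \<in> set (c \<sigma>)" "?i \<le> var l" "existential \<Phi> (var l)"
      then have "length (\<tau> @ [b]) \<le> var l" using nex by (cases "var l = ?i") auto
      then show "sgnl l \<noteq> of_bool (\<sigma> (var l))" using refutation_existential[OF c l(1)] l(3) by blast
    next
      fix \<sigma> \<sigma>' l l'
      assume l: "l \<in> set (c \<sigma>)" "l' \<in> set (c \<sigma>')" "?i \<le> var l"
        "\<not> existential \<Phi> (var l)" "var l' = var l" "sgnl l' \<noteq> sgnl l"
      \<comment> \<open>Both literals are falsified by the same move \<open>b\<close>, so at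
        \<open>?i\<close> they could not be opposite.\<close>
      have "var l \<noteq> ?i"
      proof
        assume v: "var l = ?i"
        then have "sgnl l \<noteq> of_bool b" "sgnl l' \<noteq> of_bool b"
          using refutation_assigned[OF c l(1)] refutation_assigned[OF c l(2)] l(5) by simp_all
        then show False using l sgnl_cases[of l] sgnl_cases[of l'] by (cases b) auto
      qed
      then have "length (\<tau> @ [b]) \<le> var l" using l by simp
      then obtain e where "e < var l" "length (\<tau> @ [b]) \<le> e" "existential \<Phi> e" "\<sigma> e \<noteq> \<sigma>' e"
        using refutation_universal[OF c l(1,2)] l by blast
      then show "\<exists>e < var l. ?i \<le> e \<and> existential \<Phi> e \<and> \<sigma> e \<noteq> \<sigma>' e"
        by (intro exI[of _ e]) auto
    qed (use refutation_clause[OF c] in auto)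
    ultimately have "(\<exists>c. refutation \<Phi> \<tau> c) \<longleftrightarrow> (\<exists>b c. refutation \<Phi> (\<tau> @ [b]) c)" by blast
    then show ?thesis using Universal IH by simp
  next
    case Existential
    then have ex: "existential \<Phi> ?i" using q i by (simp add: existential_def)
    have "refutation \<Phi> (\<tau> @ [b]) (\<lambda>\<sigma>. c (\<sigma>(?i := b)))" if c: "refutation \<Phi> \<tau> c" for b c
      unfolding refutation_def
    proof (intro conjI allI ballI impI)
      fix \<sigma> l assume l: "l \<in> set (c (\<sigma>(?i := b)))" "var l < length (\<tau> @ [b])"
      show "sgnl l \<noteq> of_bool ((\<tau> @ [b]) ! var l)"
      proof (cases "var l = ?i")
        case True
        then have "sgnl l \<noteq> of_bool ((\<sigma>(?i := b)) (var l))"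
          using refutation_existential[OF c l(1)] ex by simp
        then show ?thesis using True by simp
      next
        case False
        then show ?thesis using refutation_assigned[OF c l(1)] l(2) by (auto simp: nth_append)
      qed
    next
      fix \<sigma> l assume l: "l \<in> set (c (\<sigma>(?i := b)))" "length (\<tau> @ [b]) \<le> var l" "existential \<Phi> (var l)"
      then have "sgnl l \<noteq> of_bool ((\<sigma>(?i := b)) (var l))"
        using refutation_existential[OF c l(1)] by simp
      moreover have "var l \<noteq> ?i" using l(2) by auto
      ultimately show "sgnl l \<noteq> of_bool (\<sigma> (var l))" by simp
    next
      fix \<sigma> \<sigma>' l l'
      assume l: "l \<in> set (c (\<sigma>(?i := b)))" "l' \<in> set (c (\<sigma>'(?i := b)))"
        "length (\<tau> @ [b]) \<le> var l"
        "\<not> existential \<Phi> (var l)" "var l' = var l" "sgnl l' \<noteq> sgnl l"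
      then obtain e where "e < var l" "?i \<le> e" "existential \<Phi> e"
          "(\<sigma>(?i := b)) e \<noteq> (\<sigma>'(?i := b)) e"
        using refutation_universal[OF c l(1,2)] by auto
      then show "\<exists>e < var l. length (\<tau> @ [b]) \<le> e \<and> existential \<Phi> e \<and> \<sigma> e \<noteq> \<sigma>' e"
        by (intro exI[of _ e]) (auto split: if_splits)
    qed (use refutation_clause[OF c] in auto)
    \<comment> \<open>Plays with different moves at \<open>?i\<close> are answered by different
      strategies, but then \<open>?i\<close> itself is the earlier variable on which they
      diverge.\<close>
    moreover have "refutation \<Phi> \<tau> (\<lambda>\<sigma>. c (\<sigma> ?i) \<sigma>)"
      if c: "\<And>b. refutation \<Phi> (\<tau> @ [b]) (c b)" for c
      unfolding refutation_def
    proof (intro conjI allI ballI impI)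
      fix \<sigma> show "c (\<sigma> ?i) \<sigma> \<in> set (matrix \<Phi>)" by (rule refutation_clause[OF c])
    next
      fix \<sigma> l assume l: "l \<in> set (c (\<sigma> ?i) \<sigma>)" "var l < ?i"
      then have "sgnl l \<noteq> of_bool ((\<tau> @ [\<sigma> ?i]) ! var l)"
        using refutation_assigned[OF c l(1)] by simp
      then show "sgnl l \<noteq> of_bool (\<tau> ! var l)" using l by (simp add: nth_append)
    next
      fix \<sigma> l assume l: "l \<in> set (c (\<sigma> ?i) \<sigma>)" "?i \<le> var l" "existential \<Phi> (var l)"
      show "sgnl l \<noteq> of_bool (\<sigma> (var l))"
      proof (cases "var l = ?i")
        case True
        then have "sgnl l \<noteq> of_bool ((\<tau> @ [\<sigma> ?i]) ! var l)"
          using refutation_assigned[OF c l(1)] by simp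
        then show ?thesis using True by simp
      next
        case False
        then have "length (\<tau> @ [\<sigma> ?i]) \<le> var l" using l by simp
        then show ?thesis using refutation_existential[OF c l(1)] l(3) by blast
      qed
    next
      fix \<sigma> \<sigma>' l l'
      assume l: "l \<in> set (c (\<sigma> ?i) \<sigma>)" "l' \<in> set (c (\<sigma>' ?i) \<sigma>')" "?i \<le> var l"
        "\<not> existential \<Phi> (var l)" "var l' = var l" "sgnl l' \<noteq> sgnl l"
      then have less: "length (\<tau> @ [\<sigma> ?i]) \<le> var l" using ex by (cases "var l = ?i") auto
      show "\<exists>e < var l. ?i \<le> e \<and> existential \<Phi> e \<and> \<sigma> e \<noteq> \<sigma>' e"
      proof (cases "\<sigma> ?i = \<sigma>' ?i")
        case True
        then obtain e where "e < var l" "length (\<tau> @ [\<sigma> ?i]) \<le> e" "existential \<Phi> e" "\<sigma> e \<noteq> \<sigma>' e"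
          using refutation_universal[OF c l(1), of l' \<sigma>'] l less by auto
        then show ?thesis by (intro exI[of _ e]) auto
      next
        case False
        then show ?thesis using less ex by (intro exI[of _ ?i]) auto
      qed
    qed
    then have "\<exists>c. refutation \<Phi> \<tau> c" if "\<forall>b. \<exists>c. refutation \<Phi> (\<tau> @ [b]) c"
      using that by metis
    ultimately have "(\<exists>c. refutation \<Phi> \<tau> c) \<longleftrightarrow> (\<forall>b. \<exists>c. refutation \<Phi> (\<tau> @ [b]) c)" by blast
    then show ?thesis using Existential IH by simp
  qed
qed

section \<open>Tuples as numbers: assignments are numbered in base 2, tuples of clauses in base
  \<open>m\<close>\<close>

definition digit :: "nat \<Rightarrow> nat \<Rightarrow> nat \<Rightarrow> nat" where
  "digit b x i = x div b ^ i mod b"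

lemma digit_less: "0 < b \<Longrightarrow> digit b x i < b"
  by (simp add: digit_def)

lemma digit_Suc: "digit b x (Suc i) = digit b (x div b) i"
  by (simp add: digit_def div_mult2_eq)

lemma ex_digits:
  assumes "\<And>i. i < n \<Longrightarrow> t i < b"
  shows "\<exists>x < b ^ n. \<forall>i < n. digit b x i = t i"
  using assms
proof (induction n arbitrary: t)
  case (Suc n)
  obtain y where y: "y < b ^ n" "\<forall>i < n. digit b y i = t (Suc i)"
    using Suc.IH[of "\<lambda>i. t (Suc i)"] Suc.prems by auto
  have t0: "t 0 < b" using Suc.prems by simp
  let ?x = "t 0 + b * y"
  have "?x < b * (y + 1)" using t0 by simp
  also have "\<dots> \<le> b ^ Suc n" using y(1) mult_le_mono2[of "y + 1" "b ^ n" b] by simp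
  finally have "?x < b ^ Suc n" .
  moreover have "digit b ?x i = t i" if "i < Suc n" for i
    using that y t0 by (cases i) (simp_all add: digit_Suc, simp add: digit_def)
  ultimately show ?case by blast
qed simp

text \<open>\<open>E\<close> lists the set \<open>S\<close> without repetition, and \<open>X\<close> is the inverse of \<open>E\<close> shifted by 1,
  so that 0 marks the absence from \<open>S\<close>.\<close>

definition listing :: "nat \<Rightarrow> (nat \<Rightarrow> nat) \<Rightarrow> (nat \<Rightarrow> nat) \<Rightarrow> nat set \<Rightarrow> bool" where
  "listing k E X S \<longleftrightarrow>
     (\<forall>j < k. E j \<in> S \<and> X (E j) = Suc j) \<and>
     (\<forall>v \<in> S. 0 < X v \<and> X v \<le> k \<and> E (X v - 1) = v) \<and> (\<forall>v. v \<notin> S \<longrightarrow> X v = 0)"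

lemma listing_insert:
  assumes "listing k E X S" "v \<notin> S"
  shows "listing (Suc k) (E(k := v)) (X(v := Suc k)) (insert v S)"
  using assms unfolding listing_def by (auto simp: less_Suc_eq)

lemma listing_card: "listing k E X S \<Longrightarrow> card S = k"
proof -
  assume l: "listing k E X S"
  have "bij_betw E {..<k} S"
    by (rule bij_betw_byWitness[of _ "\<lambda>v. X v - 1"]) (use l in \<open>force simp: listing_def\<close>)+
  then show ?thesis by (metis bij_betw_same_card card_lessThan)
qed

definition occurring :: "qcnf \<Rightarrow> nat set" where
  "occurring \<Phi> = {v. existential \<Phi> v \<and> (\<exists>C \<in> set (matrix \<Phi>). \<exists>l \<in> set C. var l = v)}"

lemma card_occurring: "card (occurring \<Phi>) \<le> num_existential \<Phi>"
proof -
  have "occurring \<Phi> \<subseteq> {v. v < length (prefix \<Phi>) \<and> prefix \<Phi> ! v = Existential}"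
    by (auto simp: occurring_def existential_def)
  then have "card (occurring \<Phi>) \<le> card {v. v < length (prefix \<Phi>) \<and> prefix \<Phi> ! v = Existential}"
    by (intro card_mono) auto
  then show ?thesis
    by (simp add: num_existential_def count_list_eq_length_filter length_filter_conv_card eq_commute)
qed

text \<open>
  The assignment number \<open>s\<close> gives the existential variable \<open>E j\<close> the value of the \<open>j\<close>-th binary
  digit of \<open>s\<close>; the universal player answers it by falsifying the clause number \<open>T s\<close>.
\<close>

definition consistent ::
  "qcnf \<Rightarrow> nat \<Rightarrow> (nat \<Rightarrow> nat) \<Rightarrow> (nat \<Rightarrow> nat) \<Rightarrow> (nat \<Rightarrow> nat) \<Rightarrow> nat \<Rightarrow> nat \<Rightarrow> bool" where
  "consistent \<Phi> k E X T s t \<longleftrightarrow>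
     (\<forall>l \<in> set (matrix \<Phi> ! T t). \<forall>l' \<in> set (matrix \<Phi> ! T s).
        \<not> existential \<Phi> (var l) \<longrightarrow> var l' = var l \<longrightarrow> sgnl l' \<noteq> sgnl l \<longrightarrow>
        (\<exists>j < k. E j \<le> var l \<and> digit 2 s j \<noteq> digit 2 t j))"

definition falsified ::
  "qcnf \<Rightarrow> (nat \<Rightarrow> nat) \<Rightarrow> (nat \<Rightarrow> nat) \<Rightarrow> nat \<Rightarrow> bool" where
  "falsified \<Phi> X T s \<longleftrightarrow>
     (\<forall>l \<in> set (matrix \<Phi> ! T s). existential \<Phi> (var l) \<longrightarrow> digit 2 s (X (var l) - 1) \<noteq> sgnl l)"

definition refuting :: "qcnf \<Rightarrow> nat \<Rightarrow> (nat \<Rightarrow> nat) \<Rightarrow> (nat \<Rightarrow> nat) \<Rightarrow> (nat \<Rightarrow> nat) \<Rightarrow> bool" where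
  "refuting \<Phi> k E X T \<longleftrightarrow>
     (\<forall>s < 2 ^ k. falsified \<Phi> X T s \<and> (\<forall>t < 2 ^ k. consistent \<Phi> k E X T s t))"

text \<open>Plays are functions on all variables, but only their values on
  \<open>occurring \<Phi>\<close> matter. A number \<open>s\<close> becomes the play that is false
  elsewhere; conversely, a play is answered like the number formed by its values on
  \<open>E\<close>.\<close>

lemma qcnf_false_iff:
  assumes wf: "wf_qcnf \<Phi>" and l: "listing k E X (occurring \<Phi>)"
  shows "\<not> qcnf_true \<Phi> \<longleftrightarrow>
    (\<exists>T. (\<forall>s < 2 ^ k. T s < length (matrix \<Phi>)) \<and> refuting \<Phi> k E X T)"
proof -
  have var: "var l < length (prefix \<Phi>)" if "C \<in> set (matrix \<Phi>)" "l \<in> set C" for C l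
    using wf that unfolding wf_qcnf_def by blast
  have eq: "\<not> qcnf_true \<Phi> \<longleftrightarrow> (\<exists>c. refutation \<Phi> [] c)"
    using qbf_false_iff_refutation[of \<Phi> "[]" "prefix \<Phi>", OF var] by (simp add: qcnf_true_def)
  have E: "E j \<in> occurring \<Phi>" "X (E j) = Suc j" if "j < k" for j
    using l that by (auto simp: listing_def)
  have X: "0 < X v" "X v - 1 < k" "E (X v - 1) = v" if "v \<in> occurring \<Phi>" for v
    using l that by (fastforce simp: listing_def)+
  have bit: "digit 2 s j = 0 \<or> digit 2 s j = 1" for s j
    using digit_less[of 2 s j] by linarith
  show ?thesis
  proof
    assume "\<not> qcnf_true \<Phi>"
    then obtain c where c: "refutation \<Phi> [] c" using eq by blast
    define \<sigma> where "\<sigma> s v \<longleftrightarrow> v \<in> occurring \<Phi> \<and> digit 2 s (X v - 1) = 1" for s :: nat and v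
    have "c (\<sigma> s) \<in> set (matrix \<Phi>)" for s
      using c unfolding refutation_def by blast
    then have "\<exists>i < length (matrix \<Phi>). matrix \<Phi> ! i = c (\<sigma> s)" for s
      by (simp add: in_set_conv_nth)
    then obtain T where T: "\<And>s. T s < length (matrix \<Phi>)" "\<And>s. matrix \<Phi> ! T s = c (\<sigma> s)"
      by metis
    have "falsified \<Phi> X T s" for s
      unfolding falsified_def
    proof (intro ballI impI)
      fix l assume l: "l \<in> set (matrix \<Phi> ! T s)" "existential \<Phi> (var l)"
      then have "var l \<in> occurring \<Phi>" using T(1) by (auto simp: occurring_def)
      moreover have "sgnl l \<noteq> of_bool (\<sigma> s (var l))"
        using c l T(2) unfolding refutation_def by simp
      ultimately show "digit 2 s (X (var l) - 1) \<noteq> sgnl l"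
        using bit[of s "X (var l) - 1"] by (auto simp: \<sigma>_def)
    qed
    moreover have "consistent \<Phi> k E X T s t" for s t
      unfolding consistent_def
    proof (intro ballI impI)
      fix l l' assume l: "l \<in> set (matrix \<Phi> ! T t)" "l' \<in> set (matrix \<Phi> ! T s)"
        "\<not> existential \<Phi> (var l)" "var l' = var l" "sgnl l' \<noteq> sgnl l"
      then obtain e where e: "e < var l" "\<sigma> t e \<noteq> \<sigma> s e"
        using c unfolding refutation_def T(2) by (metis le0 list.size(3))
      \<comment> \<open>Both plays are false outside \<open>occurring \<Phi>\<close>, so they can
        diverge only inside it.\<close>
      then have "e \<in> occurring \<Phi>" by (auto simp: \<sigma>_def)
      then have "X e - 1 < k" "E (X e - 1) = e" "digit 2 s (X e - 1) \<noteq> digit 2 t (X e - 1)"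
        using X[of e] e by (auto simp: \<sigma>_def)
      then show "\<exists>j < k. E j \<le> var l \<and> digit 2 s j \<noteq> digit 2 t j"
        using e by (intro exI[of _ "X e - 1"]) auto
    qed
    ultimately show "\<exists>T. (\<forall>s < 2 ^ k. T s < length (matrix \<Phi>)) \<and> refuting \<Phi> k E X T"
      using T(1) unfolding refuting_def by blast
  next
    assume "\<exists>T. (\<forall>s < 2 ^ k. T s < length (matrix \<Phi>)) \<and> refuting \<Phi> k E X T"
    then obtain T where T: "\<And>s. s < 2 ^ k \<Longrightarrow> T s < length (matrix \<Phi>)"
        "\<And>s. s < 2 ^ k \<Longrightarrow> falsified \<Phi> X T s"
        "\<And>s t. s < 2 ^ k \<Longrightarrow> t < 2 ^ k \<Longrightarrow> consistent \<Phi> k E X T s t"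
      unfolding refuting_def by blast
    have "\<exists>x < 2 ^ k. \<forall>j < k. digit 2 x j = of_bool (\<sigma> (E j))" for \<sigma>
      by (rule ex_digits) auto
    then obtain x where x: "\<And>\<sigma>. x \<sigma> < 2 ^ k"
        "\<And>\<sigma> j. j < k \<Longrightarrow> digit 2 (x \<sigma>) j = of_bool (\<sigma> (E j))"
      by metis
    have "refutation \<Phi> [] (\<lambda>\<sigma>. matrix \<Phi> ! T (x \<sigma>))"
      unfolding refutation_def
    proof (intro conjI allI ballI impI)
      fix \<sigma> show "matrix \<Phi> ! T (x \<sigma>) \<in> set (matrix \<Phi>)" using T(1) x(1) by simp
    next
      fix \<sigma> l assume l: "l \<in> set (matrix \<Phi> ! T (x \<sigma>))" "existential \<Phi> (var l)"
      have "matrix \<Phi> ! T (x \<sigma>) \<in> set (matrix \<Phi>)" using T(1)[OF x(1)[of \<sigma>]] by simp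
      then have v: "var l \<in> occurring \<Phi>" using l unfolding occurring_def by blast
      have "digit 2 (x \<sigma>) (X (var l) - 1) \<noteq> sgnl l"
        using T(2)[OF x(1)[of \<sigma>]] l unfolding falsified_def by blast
      then show "sgnl l \<noteq> of_bool (\<sigma> (var l))"
        using x(2)[OF X(2)[OF v], of \<sigma>] X(3)[OF v] by simp
    next
      fix \<sigma> \<sigma>' l l'
      assume l: "l \<in> set (matrix \<Phi> ! T (x \<sigma>))" "l' \<in> set (matrix \<Phi> ! T (x \<sigma>'))"
        "\<not> existential \<Phi> (var l)" "var l' = var l" "sgnl l' \<noteq> sgnl l"
      then obtain j where j: "j < k" "E j \<le> var l" "digit 2 (x \<sigma>') j \<noteq> digit 2 (x \<sigma>) j"
        using T(3)[OF x(1) x(1)] unfolding consistent_def by blast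
      then have "existential \<Phi> (E j)" using E(1)[of j] by (simp add: occurring_def)
      \<comment> \<open>\<open>consistent\<close> uses \<open>\<le>\<close> because the table of
        differences is compared in this form; equality is excluded, as only one of the two variables
        is existential.\<close>
      then have "E j \<noteq> var l" using l(3) by auto
      then have "E j < var l" using j(2) by simp
      then show "\<exists>e < var l. length [] \<le> e \<and> existential \<Phi> e \<and> \<sigma> e \<noteq> \<sigma>' e"
        using j(3) x(2)[OF j(1), of \<sigma>] x(2)[OF j(1), of \<sigma>'] \<open>existential \<Phi> (E j)\<close>
        by (intro exI[of _ "E j"]) auto
    qed auto
    then show "\<not> qcnf_true \<Phi>" using eq by blast
  qed
qed

section \<open>Total correctness with running times\<close>

text \<open>Existence of one terminating derivation is the right notion, since the compiled code
  follows every derivation step by step. The running time is an argument of the postcondition, so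
  that time and result are established together.\<close>

definition wp :: "nat list \<Rightarrow> com \<Rightarrow> (nat \<Rightarrow> state \<Rightarrow> bool) \<Rightarrow> state \<Rightarrow> bool" where
  "wp w c Q s \<longleftrightarrow> (\<exists>t s'. big w c s t s' \<and> Q t s')"

fun mods :: "com \<Rightarrow> nat set" where
  "mods Skip = {}"
| "mods (Assign x e) = {x}"
| "mods (Read x e) = {x}"
| "mods (Put i a e) = {}"
| "mods (c ;; c') = mods c \<union> mods c'"
| "mods (If e c c') = mods c \<union> mods c'"
| "mods (While e c) = mods c"

fun amods :: "com \<Rightarrow> nat set" where
  "amods Skip = {}"
| "amods (Assign x e) = {}"
| "amods (Read x e) = {}"
| "amods (Put i a e) = {i}"
| "amods (c ;; c') = amods c \<union> amods c'"
| "amods (If e c c') = amods c \<union> amods c'"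
| "amods (While e c) = amods c"

text \<open>Syntactic frame condition: \<open>wp_mono\<close> and \<open>wp_While\<close> supply it,
  so that postconditions and invariants speak only of what a command changes.\<close>

definition agree :: "com \<Rightarrow> state \<Rightarrow> state \<Rightarrow> bool" where
  "agree c s s' \<longleftrightarrow>
     (\<forall>x. x \<notin> mods c \<longrightarrow> fst s' x = fst s x) \<and> (\<forall>i. i \<notin> amods c \<longrightarrow> snd s' i = snd s i)"

lemma big_agree: "big w c s t s' \<Longrightarrow> agree c s s'"
  by (induction rule: big.induct) (auto simp: agree_def)

lemma big_iff:
  "big w Skip s t s' \<longleftrightarrow> t = 0 \<and> s' = s"
  "big w (Assign x e) s t s' \<longleftrightarrow>
     t = ecost e + 2 \<and> s' = ((fst s)(x := eval e s), snd s)"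
  "big w (Read x e) s t s' \<longleftrightarrow>
     eval e s < length w \<and> t = ecost e + 1 \<and> s' = ((fst s)(x := w ! eval e s), snd s)"
  "big w (Put i a e) s t s' \<longleftrightarrow>
     t = ecost a + ecost e + i + 4 \<and> s' = (fst s, (snd s)(i := (snd s i)(eval a s := eval e s)))"
  "big w (c ;; c') s t s' \<longleftrightarrow> (\<exists>t1 t2 s1. t = t1 + t2 \<and> big w c s t1 s1 \<and> big w c' s1 t2 s')"
  "big w (If e c c') s t s' \<longleftrightarrow>
     (if eval e s \<noteq> 0 then \<exists>u. t = ecost e + 1 + u \<and> big w c s u s'
      else \<exists>u. t = ecost e + 2 + u \<and> big w c' s u s')"
  by - (subst big.simps, (simp; fail | (simp, metis)))+

lemma wp_simps [simp]:
  "wp w Skip Q s \<longleftrightarrow> Q 0 s"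
  "wp w (Assign x e) Q s \<longleftrightarrow> Q (ecost e + 2) ((fst s)(x := eval e s), snd s)"
  "wp w (Read x e) Q s \<longleftrightarrow>
     eval e s < length w \<and> Q (ecost e + 1) ((fst s)(x := w ! eval e s), snd s)"
  "wp w (Put i a e) Q s \<longleftrightarrow>
     Q (ecost a + ecost e + i + 4) (fst s, (snd s)(i := (snd s i)(eval a s := eval e s)))"
  "wp w (If e c c') Q s \<longleftrightarrow>
     (if eval e s \<noteq> 0 then wp w c (\<lambda>t. Q (ecost e + 1 + t)) s
      else wp w c' (\<lambda>t. Q (ecost e + 2 + t)) s)"
  unfolding wp_def big_iff by (blast, blast, blast, blast, cases "eval e s = 0", simp_all, blast+)

lemma wp_Seq: "wp w (c ;; c') Q s \<longleftrightarrow> wp w c (\<lambda>t. wp w c' (\<lambda>t'. Q (t + t'))) s"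
  unfolding wp_def big_iff by blast

lemma wp_mono:
  assumes "wp w c P s" "\<And>t s'. agree c s s' \<Longrightarrow> P t s' \<Longrightarrow> Q t s'"
  shows "wp w c Q s"
  using assms big_agree unfolding wp_def by blast

lemma agree_refl: "agree c s s"
  by (simp add: agree_def)

lemma agree_trans: "agree c s s' \<Longrightarrow> agree c s' s'' \<Longrightarrow> agree c s s''"
  by (simp add: agree_def)

text \<open>Unlike in a rule for \<open>for\<close> loops, \<open>N\<close> only bounds the number of iterations.\<close>

lemma wp_While:
  assumes I: "I 0 s"
    and step: "\<And>i s'. I i s' \<Longrightarrow> agree c s s' \<Longrightarrow> eval e s' \<noteq> 0 \<Longrightarrow>
      i < N \<and> wp w c (\<lambda>t s''. t + ecost e + 2 \<le> B i \<and> I (Suc i) s'') s'"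
    and exit: "\<And>i t s'. I i s' \<Longrightarrow> agree c s s' \<Longrightarrow> eval e s' = 0 \<Longrightarrow>
      t \<le> (\<Sum>i<N. B i) + ecost e + 2 \<Longrightarrow> Q t s'"
  shows "wp w (While e c) Q s"
proof -
  have "i \<le> N \<Longrightarrow> I i s' \<Longrightarrow> agree c s s' \<Longrightarrow>
      \<exists>t j s''. big w (While e c) s' t s'' \<and> t \<le> (\<Sum>i=i..<N. B i) + ecost e + 2 \<and>
        I j s'' \<and> agree c s s'' \<and> eval e s'' = 0" for i s'
  proof (induction "N - i" arbitrary: i s')
    case 0
    then have "eval e s' = 0" using step[of i s'] by force
    then show ?case using 0 big.WhileF[of e s' w c] by fastforce
  next
    case (Suc n)
    show ?case
    proof (cases "eval e s' = 0")
      case True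
      then show ?thesis using Suc.prems big.WhileF[of e s' w c] by fastforce
    next
      case False
      then obtain t s1 where 1: "i < N" "big w c s' t s1" "t + ecost e + 2 \<le> B i" "I (Suc i) s1"
        using step[OF Suc.prems(2,3)] unfolding wp_def by blast
      have a: "agree c s s1" using Suc.prems(3) big_agree[OF 1(2)] agree_trans by blast
      have "n = N - Suc i" "Suc i \<le> N" using Suc.hyps(2) 1(1) by simp_all
      from Suc.hyps(1)[OF this 1(4) a] obtain t' j s2 where 2: "big w (While e c) s1 t' s2"
          "t' \<le> (\<Sum>i=Suc i..<N. B i) + ecost e + 2" "I j s2" "agree c s s2" "eval e s2 = 0"
        by blast
      have "(\<Sum>i=i..<N. B i) = B i + (\<Sum>i=Suc i..<N. B i)"
        using 1(1) by (simp add: sum.atLeast_Suc_lessThan)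
      then have "ecost e + 2 + t + t' \<le> (\<Sum>i=i..<N. B i) + ecost e + 2"
        using 1(3) 2(2) by simp
      then show ?thesis using big.WhileT[OF False 1(2) 2(1)] 2 by blast
    qed
  qed
  from this[of 0 s] I agree_refl obtain t j s' where "big w (While e c) s t s'"
      "t \<le> (\<Sum>i<N. B i) + ecost e + 2" "I j s'" "agree c s s'" "eval e s' = 0"
    by (auto simp: atLeast0LessThan)
  then show ?thesis using exit unfolding wp_def by blast
qed

section \<open>The decision procedure\<close>

abbreviation (input) "x_res \<equiv> 0 :: nat"
abbreviation (input) "x_n \<equiv> 2 :: nat"
abbreviation (input) "x_m \<equiv> 3 :: nat"
abbreviation (input) "x_a \<equiv> 4 :: nat"
abbreviation (input) "x_c \<equiv> 5 :: nat"
abbreviation (input) "x_k \<equiv> 6 :: nat"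
abbreviation (input) "x_r \<equiv> 7 :: nat"
abbreviation (input) "x_v \<equiv> 8 :: nat"
abbreviation (input) "x_q \<equiv> 9 :: nat"
abbreviation (input) "x_b \<equiv> 10 :: nat"
abbreviation (input) "x_K \<equiv> 11 :: nat"
abbreviation (input) "x_j \<equiv> 12 :: nat"
abbreviation (input) "x_s \<equiv> 13 :: nat"
abbreviation (input) "x_t \<equiv> 14 :: nat"
abbreviation (input) "x_g \<equiv> 15 :: nat"
abbreviation (input) "x_f \<equiv> 16 :: nat"
abbreviation (input) "x_z \<equiv> 17 :: nat"
abbreviation (input) "x_bad \<equiv> 18 :: nat"
abbreviation (input) "x_go \<equiv> 19 :: nat"

text \<open>
  The arrays hold the addresses of the clauses, the listing \<open>E\<close>, \<open>X\<close> of the occurring existential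
  variables, the binary digits of two assignment numbers \<open>s\<close> and \<open>t\<close>, for every such pair (at
  position \<open>s K + t\<close> with \<open>K = 2^k\<close>) the least variable on which they differ, the current tuple of
  clauses, and marks on literals.
\<close>

abbreviation (input) "y_ptr \<equiv> 2 :: nat"
abbreviation (input) "y_E \<equiv> 3 :: nat"
abbreviation (input) "y_X \<equiv> 4 :: nat"
abbreviation (input) "y_\<sigma> \<equiv> 5 :: nat"
abbreviation (input) "y_\<tau> \<equiv> 6 :: nat"
abbreviation (input) "y_D \<equiv> 7 :: nat"
abbreviation (input) "y_T \<equiv> 8 :: nat"
abbreviation (input) "y_M \<equiv> 9 :: nat"

abbreviation (input) Incr :: "nat \<Rightarrow> nat \<Rightarrow> com" where
  "Incr x d \<equiv> Assign x (Plus (Var x) (Num d))"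

text \<open>Truncated subtraction makes at least one summand 0, so this is the absolute difference.
  Conditions hold when nonzero; a bare \<open>Minus a b\<close> tests a > b.\<close>

definition Neq :: "expr \<Rightarrow> expr \<Rightarrow> expr" where
  "Neq a b = Plus (Minus a b) (Minus b a)"

lemma eval_Neq [simp]: "eval (Neq a b) s = 0 \<longleftrightarrow> eval a s = eval b s"
  by (auto simp: Neq_def)

lemma ecost_Neq [simp]: "ecost (Neq a b) = 2 * (ecost a + ecost b) + 3"
  by (simp add: Neq_def)

subsection \<open>Odometers\<close>

text \<open>Afterwards \<open>x_j\<close> equals the number of digits if and only if there was an overflow.\<close>

definition increment :: "nat \<Rightarrow> expr \<Rightarrow> nat \<Rightarrow> com" where
  "increment y b len =
     Assign x_j (Num 0) ;; Assign x_f (Num 1) ;;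
     While (Var x_f)
       (If (Minus (Var len) (Var x_j))
         (If (Minus b (Plus (Arr y (Var x_j)) (Num 1)))
           (Put y (Var x_j) (Plus (Arr y (Var x_j)) (Num 1)) ;; Assign x_f (Num 0))
           (Put y (Var x_j) (Num 0) ;; Incr x_j 1))
         (Assign x_f (Num 0)))"

lemma mods_increment [simp]: "mods (increment y b len) = {x_j, x_f}"
  "amods (increment y b len) = {y}"
  by (auto simp: increment_def)

text \<open>In base \<open>b\<close>, \<open>Suc x\<close> ends in \<open>i\<close> zeros, so
  \<open>x\<close> ends in \<open>i\<close> digits \<open>b - 1\<close>, and what precedes them is
  \<open>y - 1\<close>.\<close>

lemma div_power_pred:
  assumes "0 < b" "Suc x = b ^ i * y"
  shows "0 < y" and "x div b ^ i = y - 1"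
proof -
  show "0 < y" using assms(2) by (cases y) auto
  then obtain z where y: "y = Suc z" by (cases y) auto
  have "0 < b ^ i" using assms(1) by simp
  moreover have "Suc x = b ^ i * z + b ^ i" using assms(2) y by simp
  ultimately have "b ^ i * z \<le> x" "x < b ^ i * Suc z" unfolding mult_Suc_right by linarith+
  then have "x div b ^ i = z" by (rule div_nat_eqI)
  then show "x div b ^ i = y - 1" using y by simp
qed

text \<open>\<open>b ^ i dvd Suc x\<close> says that the digits of \<open>x\<close> below
  \<open>i\<close> are all \<open>b - 1\<close>, in other words that the carry reaches position
  \<open>i\<close>. A digit \<open>b - 1\<close> there passes it on.\<close>

lemma digit_carry:
  assumes "0 < b" "b ^ i dvd Suc x" "digit b x i = b - 1"
  shows "b ^ Suc i dvd Suc x"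
proof -
  obtain y where y: "Suc x = b ^ i * y" using assms(2) by (elim dvdE)
  obtain z where z: "y = Suc z" using div_power_pred(1)[OF assms(1) y] by (cases y) auto
  have "z mod b = b - 1" using assms(3) div_power_pred(2)[OF assms(1) y] z by (simp add: digit_def)
  then have "y mod b = 0" using assms(1) z by (simp add: mod_Suc)
  then show ?thesis using y by (auto simp: mod_eq_0_iff_dvd elim!: dvdE)
qed

lemma digit_Suc_stop:
  assumes "0 < b" "b ^ i dvd Suc x" "digit b x i \<noteq> b - 1"
  shows "digit b (Suc x) l = (if l < i then 0 else if l = i then Suc (digit b x i) else digit b x l)"
proof -
  obtain y where y: "Suc x = b ^ i * y" using assms(2) by (elim dvdE)
  note y0 = div_power_pred(1)[OF assms(1) y] and xd = div_power_pred(2)[OF assms(1) y]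
  have sd: "Suc x div b ^ i = y" using y assms(1) by simp
  have ne: "(y - 1) mod b \<noteq> b - 1" using assms(3) xd by (simp add: digit_def)
  have ym: "y mod b = Suc ((y - 1) mod b)" using ne y0 assms(1) by (metis Suc_diff_1 mod_Suc diff_Suc_1)
  have yd: "y div b = (y - 1) div b"
    using ym y0 by (metis Suc_diff_1 div_Suc nat.distinct(1))
  consider "l < i" | "l = i" | "i < l" by linarith
  then show ?thesis
  proof cases
    case 1
    then have "Suc x = b ^ l * (b * (b ^ (i - l - 1) * y))"
      using y by (simp add: power_add[symmetric] mult.assoc[symmetric] power_Suc[symmetric] del: power_Suc)
    then show ?thesis using 1 assms(1) by (simp add: digit_def)
  next
    case 2
    then show ?thesis using xd sd ym by (simp add: digit_def)
  next
    case 3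
    then have l: "b ^ l = b ^ i * (b * b ^ (l - i - 1))"
      by (simp add: power_add[symmetric] power_Suc[symmetric] del: power_Suc)
    show ?thesis using 3 xd sd yd by (simp add: digit_def l div_mult2_eq)
  qed
qed

text \<open>The bound is the worst case, a carry through all digits; every use in a loop follows
  work whose budget is at least of that order. The base is either a constant or the content of
  \<open>x_m\<close>, whence the form of the last assumption.\<close>

lemma wp_increment:
  assumes y: "\<forall>i < fst s len. snd s y i = digit b x i" and x: "x < b ^ fst s len" and b: "0 < b"
    and len: "len \<noteq> x_j" "len \<noteq> x_f"
    and e: "\<And>s'. fst s' x_m = fst s x_m \<Longrightarrow> eval e s' = b"
  shows "wp w (increment y e len)
    (\<lambda>t s'. t \<le> (100 + 4 * y + ecost e) * (fst s len + 2) \<and>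
      (\<forall>i < fst s len. snd s' y i = digit b (Suc x) i) \<and>
      (fst s' x_j = fst s len \<longleftrightarrow> Suc x = b ^ fst s len)) s"
proof -
  let ?n = "fst s len"
  have over: "Suc x = b ^ ?n" if "b ^ ?n dvd Suc x"
    using x dvd_imp_le[OF that] by simp
  define I where "I i s' \<longleftrightarrow>
    (if fst s' x_f = 0 then (\<forall>i < ?n. snd s' y i = digit b (Suc x) i) \<and>
        (fst s' x_j = ?n \<longleftrightarrow> Suc x = b ^ ?n)
      else fst s' x_j = i \<and> i \<le> ?n \<and> b ^ i dvd Suc x \<and>
        (\<forall>l < ?n. snd s' y l = (if l < i then 0 else digit b x l)))" for i :: nat and s' :: state
  show ?thesis
    unfolding increment_def
    apply (simp add: wp_Seq)
    \<comment> \<open>One iteration more than there are digits: on overflow the last one only clears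
      the flag.\<close>
    apply (rule wp_While[where I = I and N = "Suc ?n" and B = "\<lambda>_. 90 + 4 * y + ecost e"])
    subgoal using y by (simp add: I_def)
    subgoal premises p for i s'
    proof -
      have fr: "fst s' len = ?n" "eval e s' = b"
        using p(2) len by (auto simp: agree_def intro!: e)
      have j: "fst s' x_j = i" "i \<le> ?n" "b ^ i dvd Suc x"
          "\<forall>l < ?n. snd s' y l = (if l < i then 0 else digit b x l)"
        using p(1,3) by (auto simp: I_def)
      have f: "fst s' x_f \<noteq> 0" using p(3) by simp
      show ?thesis
      proof (cases "i = ?n")
        case True
        then have "Suc x = b ^ ?n" using over j(3) by simp
        \<comment> \<open>On overflow the array holds only zeros, which are the low digits of
          \<open>b ^ ?n\<close>.\<close>
        moreover have "digit b (b ^ ?n) l = 0" if "l < ?n" for l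
        proof -
          have "b ^ ?n = b ^ l * (b * b ^ (?n - l - 1))"
            using that by (simp add: power_add[symmetric] power_Suc[symmetric] del: power_Suc)
          then show ?thesis using b by (simp add: digit_def)
        qed
        ultimately show ?thesis using True j fr by (simp add: I_def wp_Seq)
      next
        case False
        then have i: "i < ?n" using j by simp
        then have d: "snd s' y i = digit b x i" using j by simp
        show ?thesis
        proof (cases "digit b x i = b - 1")
          case True
          then show ?thesis using i j f fr d digit_carry[OF b j(3) True] b
            by (auto simp: I_def wp_Seq less_Suc_eq)
        next
          case F: False
          have "digit b x i < b" using b by (rule digit_less)
          then have 1: "b - Suc (digit b x i) \<noteq> 0" using F by simp
          have 2: "Suc x \<noteq> b ^ ?n"
          proof
            assume "Suc x = b ^ ?n"
            then have "b ^ Suc i dvd Suc x" using i by (simp add: le_imp_power_dvd Suc_leI del: power_Suc)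
            then have "digit b (Suc x) i = 0"
              using b by (auto simp: digit_def elim!: dvdE)
            then show False using digit_Suc_stop[OF b j(3) F, of i] by simp
          qed
          show ?thesis using i j fr d 1 2 digit_Suc_stop[OF b j(3) F]
            by (auto simp: I_def wp_Seq)
        qed
      qed
    qed
    subgoal for i t s' by (simp add: I_def algebra_simps)
    done
qed


subsection \<open>Reading the formula\<close>

locale formula =
  fixes \<Phi> :: qcnf
  assumes wf: "wf_qcnf \<Phi>"
begin

abbreviation w :: "nat list" where "w \<equiv> enc_qcnf \<Phi>"
abbreviation n :: nat where "n \<equiv> length (prefix \<Phi>)"
abbreviation m :: nat where "m \<equiv> length (matrix \<Phi>)"
abbreviation C :: "nat \<Rightarrow> literal list" where "C c \<equiv> matrix \<Phi> ! c"

text \<open>Address of the length word of clause \<open>c\<close>: the summand \<open>n + 2\<close>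
  covers the quantifiers and the length words of the prefix and of the matrix.\<close>

definition off :: "nat \<Rightarrow> nat" where
  "off c = n + 2 + (\<Sum>i<c. 1 + 2 * length (C i))"

lemma off_Suc: "off (Suc c) = off c + 1 + 2 * length (C c)"
  by (simp add: off_def)

lemma var_less: "c < m \<Longrightarrow> i < length (C c) \<Longrightarrow> var (C c ! i) < n"
  using wf unfolding wf_qcnf_def by (meson nth_mem)

lemma length_enc_literals: "length (concat (map enc_literal ls)) = 2 * length ls"
proof (induction ls)
  case (Cons l ls)
  then show ?case by (cases l) auto
qed simp

lemma nth_enc_literals:
  "i < length ls \<Longrightarrow> concat (map enc_literal ls) ! (2 * i) = sgnl (ls ! i) \<and>
    concat (map enc_literal ls) ! Suc (2 * i) = var (ls ! i)"
proof (induction ls arbitrary: i)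
  case (Cons l ls)
  then show ?case by (cases l; cases i) auto
qed simp

lemma length_enc_clauses:
  "length (concat (map enc_clause (take c (matrix \<Phi>)))) = (\<Sum>i<c. 1 + 2 * length (C i))" if "c \<le> m"
  using that
proof (induction c)
  case (Suc c)
  then show ?case
    by (simp add: take_Suc_conv_app_nth enc_clause_def length_enc_literals)
qed simp

lemma w_split:
  assumes "c < m"
  obtains xs ys where "w = xs @ enc_clause (C c) @ ys" "length xs = off c"
proof -
  let ?xs = "n # map enc_quantifier (prefix \<Phi>) @ m # concat (map enc_clause (take c (matrix \<Phi>)))"
  have "w = ?xs @ enc_clause (C c) @ concat (map enc_clause (drop (Suc c) (matrix \<Phi>)))"
  proof -
    have "concat (map enc_clause (matrix \<Phi>)) =
        concat (map enc_clause (take c (matrix \<Phi>) @ C c # drop (Suc c) (matrix \<Phi>)))"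
      using id_take_nth_drop[OF assms] by simp
    then show ?thesis by (simp add: enc_qcnf_def enc_matrix_def)
  qed
  moreover have "length ?xs = off c"
    using assms length_enc_clauses[of c] by (simp add: off_def)
  ultimately show ?thesis using that by blast
qed

lemma w_0: "0 < length w" "w ! 0 = n"
  by (simp_all add: enc_qcnf_def)

lemma w_quantifier:
  "v < n \<Longrightarrow> Suc v < length w"
  "v < n \<Longrightarrow> w ! Suc v = of_bool (existential \<Phi> v)"
  by (simp_all add: enc_qcnf_def nth_append existential_def)
    (cases "prefix \<Phi> ! v"; simp)

lemma w_m: "Suc n < length w" "w ! Suc n = m"
  by (simp_all add: enc_qcnf_def enc_matrix_def nth_append)

lemma w_clause: "off c < length w" "w ! off c = length (C c)" if c: "c < m"
proof -
  obtain xs ys where "w = xs @ enc_clause (C c) @ ys" "length xs = off c"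
    using w_split[OF c] .
  then show "off c < length w" "w ! off c = length (C c)"
    by (simp_all add: enc_clause_def nth_append)
qed

lemma w_literal:
  "off c + 2 * i + 2 < length w"
  "w ! (off c + 2 * i + 1) = sgnl (C c ! i)"
  "w ! (off c + 2 * i + 2) = var (C c ! i)" if c: "c < m" and i: "i < length (C c)"
proof -
  obtain xs ys where w: "w = xs @ enc_clause (C c) @ ys" "length xs = off c"
    using w_split[OF c] .
  show "off c + 2 * i + 2 < length w"
    using i by (simp add: w length_enc_literals enc_clause_def)
  have "w ! (off c + k + 1) = concat (map enc_literal (C c)) ! k" if "k < 2 * length (C c)" for k
    using that by (simp add: w(1) w(2)[symmetric] nth_append enc_clause_def length_enc_literals)
  from this[of "2 * i"] this[of "2 * i + 1"]
  show "w ! (off c + 2 * i + 1) = sgnl (C c ! i)" "w ! (off c + 2 * i + 2) = var (C c ! i)"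
    using i nth_enc_literals[OF i] by simp_all
qed

text \<open>The part of \<open>occurring \<Phi>\<close> contributed by the literals read so far, for
  the loop invariants.\<close>

definition exvars :: "literal list \<Rightarrow> nat set" where
  "exvars ls = {v. existential \<Phi> v \<and> (\<exists>l \<in> set ls. var l = v)}"

lemma exvars_append: "exvars (ls @ ls') = exvars ls \<union> exvars ls'"
  by (auto simp: exvars_def)

lemma exvars_single:
  "exvars [l] = (if existential \<Phi> (var l) then {var l} else {})"
  by (auto simp: exvars_def)

lemma exvars_all: "exvars (concat (matrix \<Phi>)) = occurring \<Phi>"
  by (auto simp: exvars_def occurring_def)

end

text \<open>The entry of \<open>y_X\<close> is written after \<open>x_k\<close> was increased, hence
  the shift by 1 in \<open>listing\<close>; a zero entry means that the variable is new. As the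
  memory starts with zeros, nothing is initialised and the time does not depend on the length of the
  prefix.\<close>

definition collect_clause :: com where
  "collect_clause =
     While (Var x_r)
       (Read x_v (Plus (Var x_a) (Num 1)) ;; Read x_q (Plus (Var x_v) (Num 1)) ;;
        If (Var x_q)
          (If (Arr y_X (Var x_v)) Skip
            (Put y_E (Var x_k) (Var x_v) ;; Incr x_k 1 ;; Put y_X (Var x_v) (Var x_k)))
          Skip ;;
        Incr x_a 2 ;; Assign x_r (Minus (Var x_r) (Num 1)))"

definition collect :: com where
  "collect =
     While (Minus (Var x_m) (Var x_c))
       (Put y_ptr (Var x_c) (Var x_a) ;; Read x_r (Var x_a) ;; Incr x_a 1 ;;
        collect_clause ;; Incr x_c 1)"

lemma mods_collect_clause [simp]: "mods collect_clause = {x_v, x_q, x_k, x_a, x_r}"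
  "amods collect_clause = {y_E, y_X}"
  by (auto simp: collect_clause_def)

context formula
begin

lemma wp_collect_clause:
  assumes c: "c < m" and a: "fst s x_a = off c + 1" "fst s x_r = length (C c)"
    and l: "listing (fst s x_k) (snd s y_E) (snd s y_X) (exvars (concat (take c (matrix \<Phi>))))"
  shows "wp w collect_clause (\<lambda>t s'. t \<le> 150 * length (C c) + 4 \<and> fst s' x_a = off (Suc c) \<and>
    listing (fst s' x_k) (snd s' y_E) (snd s' y_X) (exvars (concat (take (Suc c) (matrix \<Phi>))))) s"
proof -
  let ?S = "\<lambda>i. exvars (concat (take c (matrix \<Phi>)) @ take i (C c))"
  define I where "I i s' \<longleftrightarrow> i \<le> length (C c) \<and> fst s' x_a = off c + 1 + 2 * i \<and>
    fst s' x_r = length (C c) - i \<and> listing (fst s' x_k) (snd s' y_E) (snd s' y_X) (?S i)"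
    for i and s' :: state
  show ?thesis
    unfolding collect_clause_def
    apply (rule wp_While[where I = I and N = "length (C c)" and B = "\<lambda>_. 150"])
    subgoal using a l by (simp add: I_def)
    subgoal premises p for i s'
    proof -
      have i: "i < length (C c)" "fst s' x_a = off c + 1 + 2 * i" "fst s' x_r = length (C c) - i"
          and l: "listing (fst s' x_k) (snd s' y_E) (snd s' y_X) (?S i)"
        using p(1,3) by (auto simp: I_def)
      let ?v = "var (C c ! i)"
      have S: "?S (Suc i) = ?S i \<union> (if existential \<Phi> ?v then {?v} else {})"
        using i(1) by (simp add: take_Suc_conv_app_nth exvars_append exvars_single Un_assoc)
      have X: "snd s' y_X ?v = 0 \<longleftrightarrow> ?v \<notin> ?S i" using l by (auto simp: listing_def)
      have l1: "listing (Suc (fst s' x_k)) ((snd s' y_E)(fst s' x_k := ?v))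
          ((snd s' y_X)(?v := Suc (fst s' x_k))) (insert ?v (?S i))" if "?v \<notin> ?S i"
        using listing_insert[OF l that] .
      show ?thesis
        using i w_literal[OF c i(1)] w_quantifier[OF var_less[OF c i(1)]] l l1 X S
        by (auto simp: I_def wp_Seq insert_absorb)
    qed
    subgoal for i t s'
      using c by (auto simp: I_def off_Suc take_Suc_conv_app_nth)
    done
qed

lemma wp_collect:
  assumes "fst s x_m = m" "fst s x_c = 0" "fst s x_k = 0" "fst s x_a = n + 2"
    and "snd s y_X = (\<lambda>_. 0)"
  shows "wp w collect (\<lambda>t s'. t \<le> 200 * matrix_size \<Phi> \<and> (\<forall>c < m. snd s' y_ptr c = off c) \<and>
    listing (fst s' x_k) (snd s' y_E) (snd s' y_X) (occurring \<Phi>)) s"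
proof -
  define I where "I i s' \<longleftrightarrow> i \<le> m \<and> fst s' x_c = i \<and> fst s' x_a = off i \<and>
    (\<forall>c < i. snd s' y_ptr c = off c) \<and>
    listing (fst s' x_k) (snd s' y_E) (snd s' y_X) (exvars (concat (take i (matrix \<Phi>))))"
    for i and s' :: state
  have size: "matrix_size \<Phi> = 1 + (\<Sum>i<m. 1 + 2 * length (C i))"
    using length_enc_clauses[of m] by (simp add: matrix_size_def enc_matrix_def)
  show ?thesis
    unfolding collect_def
    \<comment> \<open>The budget of a clause is proportional to the
      \<open>1 + 2 * length (C i)\<close> words of its encoding, so the budgets add up to a multiple
      of \<open>matrix_size \<Phi>\<close>.\<close>
    apply (rule wp_While[where I = I and N = m and B = "\<lambda>i. 100 * (1 + 2 * length (C i))"])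
    subgoal using assms by (simp add: I_def exvars_def listing_def off_def)
    subgoal premises p for i s'
    proof -
      have fr: "fst s' x_m = m" using p(2) assms by (simp add: agree_def)
      have i: "i < m" "fst s' x_c = i" "fst s' x_a = off i" "\<forall>c < i. snd s' y_ptr c = off c"
          and l: "listing (fst s' x_k) (snd s' y_E) (snd s' y_X)
            (exvars (concat (take i (matrix \<Phi>))))"
        using p(1,3) fr by (auto simp: I_def)
      show ?thesis
        apply (simp add: wp_Seq i w_clause)
        apply (rule wp_mono[OF wp_collect_clause[OF i(1)]])
        using i l by (auto simp: I_def agree_def less_Suc_eq)
    qed
    subgoal premises p for i t s'
    proof -
      have fr: "fst s' x_m = m" using p(2) assms by (simp add: agree_def)
      then have "i = m" using p(1,3) by (simp add: I_def)
      moreover have "t \<le> 100 * (\<Sum>i<m. 1 + 2 * length (C i)) + 7"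
        using p(4) unfolding sum_distrib_left by simp
      ultimately show ?thesis using p(1) unfolding I_def size by (simp add: exvars_all)
    qed
    done
qed

end

subsection \<open>Comparing assignments\<close>

definition power_of_two :: com where
  "power_of_two =
     Assign x_K (Num 1) ;; Assign x_j (Num 0) ;;
     While (Minus (Var x_k) (Var x_j)) (Assign x_K (Plus (Var x_K) (Var x_K)) ;; Incr x_j 1)"

lemma mods_power_of_two [simp]: "mods power_of_two = {x_K, x_j}" "amods power_of_two = {}"
  by (auto simp: power_of_two_def)

lemma wp_power_of_two:
  "wp w power_of_two (\<lambda>t s'. t \<le> 50 * (fst s x_k + 1) \<and> fst s' x_K = 2 ^ fst s x_k) s"
  unfolding power_of_two_def
  apply (simp add: wp_Seq)
  apply (rule wp_While[where I = "\<lambda>i s'. i \<le> fst s x_k \<and> fst s' x_j = i \<and> fst s' x_K = 2 ^ i"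
      and N = "fst s x_k" and B = "\<lambda>_. 50"])
  by (auto simp: wp_Seq agree_def)

text \<open>The variables are listed in the order of their occurrence in the matrix, not in prefix
  order, so the least difference is a minimum over all \<open>j\<close>. The start value, the length
  of the prefix, exceeds every variable and stands for no difference.\<close>

definition first_difference :: com where
  "first_difference =
     Assign x_g (Var x_n) ;; Assign x_j (Num 0) ;;
     While (Minus (Var x_k) (Var x_j))
       (If (Neq (Arr y_\<sigma> (Var x_j)) (Arr y_\<tau> (Var x_j)))
         (If (Minus (Var x_g) (Arr y_E (Var x_j))) (Assign x_g (Arr y_E (Var x_j))) Skip)
         Skip ;;
        Incr x_j 1)"

lemma mods_first_difference [simp]:
  "mods first_difference = {x_g, x_j}" "amods first_difference = {}"
  by (auto simp: first_difference_def)

lemma wp_first_difference: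
  "wp w first_difference (\<lambda>t s'. t \<le> 200 * (fst s x_k + 1) \<and>
     (\<forall>v < fst s x_n. v < fst s' x_g \<longleftrightarrow>
       (\<forall>j < fst s x_k. snd s y_E j \<le> v \<longrightarrow> snd s y_\<sigma> j = snd s y_\<tau> j))) s"
proof -
  define I where "I i s' \<longleftrightarrow> i \<le> fst s x_k \<and> fst s' x_j = i \<and>
    (\<forall>v < fst s x_n. v < fst s' x_g \<longleftrightarrow>
      (\<forall>j < i. snd s y_E j \<le> v \<longrightarrow> snd s y_\<sigma> j = snd s y_\<tau> j))" for i and s' :: state
  show ?thesis
    unfolding first_difference_def
    apply (simp add: wp_Seq)
    apply (rule wp_While[where I = I and N = "fst s x_k" and B = "\<lambda>_. 150"])
    subgoal by (simp add: I_def)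
    subgoal by (auto simp: I_def wp_Seq agree_def less_Suc_eq)
    subgoal by (auto simp: I_def agree_def)
    done
qed

text \<open>\<open>x_q\<close> runs through the table row by row, which yields the position
  \<open>s K + t\<close> without multiplication.\<close>

definition table_row :: com where
  "table_row =
     While (Minus (Var x_K) (Var x_t))
       (first_difference ;; Put y_D (Var x_q) (Var x_g) ;; Incr x_q 1 ;;
        increment y_\<tau> (Num 2) x_k ;; Incr x_t 1)"

lemma mods_table_row [simp]:
  "mods table_row = {x_g, x_j, x_q, x_f, x_t}" "amods table_row = {y_D, y_\<tau>}"
  by (auto simp: table_row_def)

definition table :: com where
  "table =
     Assign x_q (Num 0) ;; Assign x_s (Num 0) ;;
     While (Minus (Var x_K) (Var x_s))
       (Assign x_t (Num 0) ;; table_row ;;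
        increment y_\<sigma> (Num 2) x_k ;; Incr x_s 1)"

text \<open>A counter that has run through all its values holds the digits of \<open>b ^ k\<close>.
  So a complete loop leaves its counter reset for the next use.\<close>

lemma digit_overflow: "0 < b \<Longrightarrow> i < k \<Longrightarrow> digit b (b ^ k) i = 0"
proof -
  assume "0 < b" "i < k"
  then have "b ^ k = b ^ i * (b * b ^ (k - i - 1))"
    by (simp add: power_add[symmetric] power_Suc[symmetric] del: power_Suc)
  then show ?thesis using \<open>0 < b\<close> by (simp add: digit_def)
qed

lemma digit_0: "digit b 0 i = 0"
  by (simp add: digit_def)

context formula
begin

definition entry :: "nat \<Rightarrow> (nat \<Rightarrow> nat) \<Rightarrow> nat \<Rightarrow> nat \<Rightarrow> nat \<Rightarrow> bool" where
  "entry k E g s t \<longleftrightarrow> (\<forall>v < n. v < g \<longleftrightarrow> (\<forall>j < k. E j \<le> v \<longrightarrow> digit 2 s j = digit 2 t j))"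

lemma wp_table_row:
  assumes n: "fst s x_n = n" and K: "fst s x_K = 2 ^ fst s x_k"
    and t: "fst s x_t = 0" and q: "fst s x_q = fst s x_s * fst s x_K"
    and \<sigma>: "\<forall>j < fst s x_k. snd s y_\<sigma> j = digit 2 (fst s x_s) j"
    and \<tau>: "\<forall>j < fst s x_k. snd s y_\<tau> j = 0"
    and D: "\<forall>p < fst s x_q. entry (fst s x_k) (snd s y_E) (snd s y_D p) (p div fst s x_K) (p mod fst s x_K)"
  shows "wp w table_row
    (\<lambda>t s'. t \<le> fst s x_K * (400 * (fst s x_k + 2)) + 10 \<and>
      fst s' x_q = Suc (fst s x_s) * fst s x_K \<and> (\<forall>j < fst s x_k. snd s' y_\<tau> j = 0) \<and>
      (\<forall>p < fst s' x_q. entry (fst s x_k) (snd s y_E) (snd s' y_D p) (p div fst s x_K) (p mod fst s x_K))) s"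
proof -
  let ?k = "fst s x_k" and ?K = "fst s x_K" and ?s = "fst s x_s" and ?E = "snd s y_E"
  define I where "I i s' \<longleftrightarrow> i \<le> ?K \<and> fst s' x_t = i \<and> fst s' x_q = ?s * ?K + i \<and>
    (\<forall>j < ?k. snd s' y_\<tau> j = digit 2 i j) \<and>
    (\<forall>p < ?s * ?K + i. entry ?k ?E (snd s' y_D p) (p div ?K) (p mod ?K))" for i and s' :: state
  show ?thesis
    unfolding table_row_def
    apply (rule wp_While[where I = I and N = ?K and B = "\<lambda>_. 400 * (?k + 2)"])
    subgoal using assms by (simp add: I_def digit_0)
    subgoal premises p for i s'
    proof -
      have fr: "fst s' x_n = n" "fst s' x_k = ?k" "fst s' x_K = ?K" "fst s' x_s = ?s"
          "snd s' y_E = ?E" "snd s' y_\<sigma> = snd s y_\<sigma>"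
        using p(2) n by (simp_all add: agree_def)
      have i: "i < ?K" "fst s' x_t = i" "fst s' x_q = ?s * ?K + i"
          "\<forall>j < ?k. snd s' y_\<tau> j = digit 2 i j"
          "\<forall>p < ?s * ?K + i. entry ?k ?E (snd s' y_D p) (p div ?K) (p mod ?K)"
        using p(1,3) fr by (auto simp: I_def)
      show ?thesis
        apply (simp add: wp_Seq i)
        apply (rule wp_mono[OF wp_first_difference])
        subgoal premises p1 for t1 s1
        proof -
          have fr1: "fst s1 x_t = i" "fst s1 x_k = ?k" "fst s1 x_K = ?K"
              "fst s1 x_q = ?s * ?K + i" "snd s1 = snd s'"
            using p1(1) fr i by (auto simp: agree_def)
          have g: "entry ?k ?E (fst s1 x_g) ?s i"
            using p1(2) fr i(4) \<sigma> by (simp add: entry_def)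
          have dm: "(?s * ?K + i) div ?K = ?s" "(?s * ?K + i) mod ?K = i" using i(1) by simp_all
          show ?thesis
            apply (simp add: wp_Seq)
            apply (rule wp_mono[OF wp_increment[where b = 2 and x = i]])
            using i K fr1 apply (simp_all)
            subgoal premises p2 for t2 s2
            proof -
              have "\<forall>j < ?k. snd s2 y_\<tau> j = digit 2 (Suc i) j" using p2 fr1 by auto
              moreover have "snd s2 y_D = (snd s1 y_D)(?s * ?K + i := fst s1 x_g)"
                  "fst s2 x_t = i" "fst s2 x_q = Suc (?s * ?K + i)"
                using p2 fr1 by (auto simp: agree_def)
              moreover have "entry ?k ?E (snd s2 y_D p) (p div ?K) (p mod ?K)"
                if "p < Suc (?s * ?K + i)" for p
                using that i(5) g dm calculation(2) fr1 by (cases "p = ?s * ?K + i") auto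
              ultimately show ?thesis using p2 i p1 fr fr1 by (simp add: I_def)
            qed
            done
        qed
        done
    qed
    subgoal premises p for i t s'
    proof -
      have "fst s' x_K = ?K" using p(2) by (simp add: agree_def)
      then have "i = ?K" using p(1,3) by (simp add: I_def)
      then show ?thesis using p(1,4) K digit_overflow[of 2 _ ?k] by (simp add: I_def)
    qed
    done
qed

lemma wp_table:
  assumes n: "fst s x_n = n" and K: "fst s x_K = 2 ^ fst s x_k"
    and \<sigma>: "\<forall>j < fst s x_k. snd s y_\<sigma> j = 0"
    and \<tau>: "\<forall>j < fst s x_k. snd s y_\<tau> j = 0"
  shows "wp w table (\<lambda>t s'. t \<le> 1000 * fst s x_K * fst s x_K * (fst s x_k + 2) \<and>
      (\<forall>j < fst s x_k. snd s' y_\<sigma> j = 0) \<and>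
      (\<forall>p < fst s x_K * fst s x_K.
        entry (fst s x_k) (snd s y_E) (snd s' y_D p) (p div fst s x_K) (p mod fst s x_K))) s"
proof -
  let ?k = "fst s x_k" and ?K = "fst s x_K" and ?E = "snd s y_E"
  define I where "I i s' \<longleftrightarrow> i \<le> ?K \<and> fst s' x_s = i \<and> fst s' x_q = i * ?K \<and>
    (\<forall>j < ?k. snd s' y_\<sigma> j = digit 2 i j) \<and> (\<forall>j < ?k. snd s' y_\<tau> j = 0) \<and>
    (\<forall>p < i * ?K. entry ?k ?E (snd s' y_D p) (p div ?K) (p mod ?K))" for i and s' :: state
  have K1: "1 \<le> ?K" using K by simp
  show ?thesis
    unfolding table_def
    apply (simp add: wp_Seq)
    apply (rule wp_While[where I = I and N = ?K and B = "\<lambda>_. ?K * (700 * (?k + 2))"])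
    subgoal using \<sigma> \<tau> by (simp add: I_def digit_0)
    subgoal premises p for i s'
    proof -
      have fr: "fst s' x_n = n" "fst s' x_k = ?k" "fst s' x_K = ?K" "snd s' y_E = ?E"
        using p(2) n by (simp_all add: agree_def)
      have i: "i < ?K" "fst s' x_s = i" "fst s' x_q = i * ?K"
          "\<forall>j < ?k. snd s' y_\<sigma> j = digit 2 i j" "\<forall>j < ?k. snd s' y_\<tau> j = 0"
          "\<forall>p < i * ?K. entry ?k ?E (snd s' y_D p) (p div ?K) (p mod ?K)"
        using p(1,3) fr by (auto simp: I_def)
      show ?thesis
        apply (simp add: wp_Seq i)
        apply (rule wp_mono[OF wp_table_row])
        using i fr K apply (simp_all)
        subgoal premises p1 for t1 s1
        proof -
          have fr1: "fst s1 x_s = i" "fst s1 x_k = ?k" "snd s1 y_\<sigma> = snd s' y_\<sigma>"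
            using p1 fr i by (auto simp: agree_def)
          show ?thesis
            apply (simp add: wp_Seq)
            apply (rule wp_mono[OF wp_increment[where b = 2 and x = i]])
            using i K fr1 apply (simp_all)
            subgoal premises p2 for t2 s2
            proof -
              have a: "snd s2 y_D = snd s1 y_D" "snd s2 y_\<tau> = snd s1 y_\<tau>"
                  "fst s2 x_s = i" "fst s2 x_q = fst s1 x_q"
                using p2 fr1 by (auto simp: agree_def)
              \<comment> \<open>With the product as an atom, the time estimate becomes
                linear.\<close>
              define u where "u = ?K * (?k + 2)"
              have "?k + 2 \<le> u" using mult_le_mono1[OF K1, of "?k + 2"] by (simp add: u_def)
              moreover have "t1 \<le> 400 * u + 10" using p1(2) K by (simp add: u_def algebra_simps)
              moreover have "t2 \<le> 121 * (?k + 2)" using p2(2) by simp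
              ultimately have "t1 + t2 + 50 \<le> 700 * u" by simp
              then have "t1 + t2 + 50 \<le> ?K * (700 * (?k + 2))" by (simp add: u_def algebra_simps)
              then show ?thesis using a p2 p1 i fr K by (simp add: I_def algebra_simps)
            qed
            done
        qed
        done
    qed
    subgoal premises p for i t s'
    proof -
      have "fst s' x_K = ?K" using p(2) by (simp add: agree_def)
      then have "i = ?K" using p(1,3) by (simp add: I_def)
      moreover have "6 + t \<le> 1000 * ?K * ?K * (?k + 2)"
      proof -
        define u where "u = ?K * (?K * (?k + 2))"
        have "1 * (1 * 1) \<le> u"
          using K1 unfolding u_def by (intro mult_le_mono) auto
        moreover have "t \<le> 700 * u + 7" using p(4) by (simp add: u_def algebra_simps)
        ultimately have "6 + t \<le> 1000 * u" by simp
        then show ?thesis by (simp only: u_def mult.assoc)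
      qed
      ultimately show ?thesis
        using p(1) K digit_overflow[of 2 _ ?k] by (simp add: I_def)
    qed
    done
qed

end


subsection \<open>Checking a tuple of clauses\<close>

text \<open>
  Array \<open>y_M\<close> marks the universal literals of the clause under consideration with the current
  value of \<open>x_z\<close>, which is never used again; so the marks need not be erased.
\<close>

definition mark :: com where
  "mark =
     Read x_r (Var x_a) ;; Incr x_a 1 ;;
     While (Var x_r)
       (Read x_b (Var x_a) ;; Read x_v (Plus (Var x_a) (Num 1)) ;;
        Read x_f (Plus (Var x_v) (Num 1)) ;;
        If (Var x_f)
          (If (Neq (Arr y_\<sigma> (Minus (Arr y_X (Var x_v)) (Num 1))) (Var x_b)) Skip
            (Assign x_bad (Num 1)))
          (Put y_M (Plus (Plus (Var x_v) (Var x_v)) (Var x_b)) (Var x_z)) ;;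
        Incr x_a 2 ;; Assign x_r (Minus (Var x_r) (Num 1)))"

text \<open>\<open>2 v + 1 - b\<close> is the code of the complementary literal. The quantifier of
  \<open>v\<close> is not looked up again, because \<open>mark\<close> only marks universal
  literals. A marked complement is an offence if \<open>v\<close> lies before the first difference
  of the two assignments.\<close>

definition compare :: com where
  "compare =
     Read x_r (Var x_a) ;; Incr x_a 1 ;;
     While (Var x_r)
       (Read x_b (Var x_a) ;; Read x_v (Plus (Var x_a) (Num 1)) ;;
        If (Neq (Arr y_M (Minus (Plus (Plus (Var x_v) (Var x_v)) (Num 1)) (Var x_b))) (Var x_z)) Skip
          (If (Minus (Arr y_D (Var x_q)) (Var x_v)) (Assign x_bad (Num 1)) Skip) ;;
        Incr x_a 2 ;; Assign x_r (Minus (Var x_r) (Num 1)))"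

lemma mods_mark [simp]: "mods mark = {x_r, x_a, x_b, x_v, x_f, x_bad}" "amods mark = {y_M}"
  by (auto simp: mark_def)

lemma mods_compare [simp]: "mods compare = {x_r, x_a, x_b, x_v, x_bad}" "amods compare = {}"
  by (auto simp: compare_def)

definition code :: "literal \<Rightarrow> nat" where
  "code l = 2 * var l + sgnl l"

lemma bex_set_conv_nth: "(\<exists>x \<in> set xs. P x) \<longleftrightarrow> (\<exists>i < length xs. P (xs ! i))"
  by (metis in_set_conv_nth)

lemma code_complement:
  "code l' = 2 * var l + 1 - sgnl l \<longleftrightarrow> var l' = var l \<and> sgnl l' \<noteq> sgnl l"
  by (cases l; cases l') (auto simp: code_def, presburger+)

context formula
begin

lemma wp_mark:
  assumes c: "c < m" "fst s x_a = off c" and M: "\<forall>x. snd s y_M x < fst s x_z"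
  shows "wp w mark (\<lambda>t s'. t \<le> 200 * (length (C c) + 1) \<and>
    (\<forall>x. snd s' y_M x \<le> fst s x_z) \<and>
    (\<forall>x. snd s' y_M x = fst s x_z \<longleftrightarrow> (\<exists>l \<in> set (C c). \<not> existential \<Phi> (var l) \<and> x = code l)) \<and>
    (fst s' x_bad = 0 \<longleftrightarrow> fst s x_bad = 0 \<and>
      (\<forall>l \<in> set (C c). existential \<Phi> (var l) \<longrightarrow> snd s y_\<sigma> (snd s y_X (var l) - 1) \<noteq> sgnl l))) s"
proof -
  let ?n = "length (C c)" and ?z = "fst s x_z"
  let ?ok = "\<lambda>l. existential \<Phi> (var l) \<longrightarrow> snd s y_\<sigma> (snd s y_X (var l) - 1) \<noteq> sgnl l"
  define I where "I i s' \<longleftrightarrow> i \<le> ?n \<and> fst s' x_a = off c + 1 + 2 * i \<and> fst s' x_r = ?n - i \<and>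
    (\<forall>x. snd s' y_M x \<le> ?z) \<and>
    (\<forall>x. snd s' y_M x = ?z \<longleftrightarrow> (\<exists>j < i. \<not> existential \<Phi> (var (C c ! j)) \<and> x = code (C c ! j))) \<and>
    (fst s' x_bad = 0 \<longleftrightarrow> fst s x_bad = 0 \<and> (\<forall>j < i. ?ok (C c ! j)))" for i and s' :: state
  show ?thesis
    unfolding mark_def
    apply (simp add: wp_Seq c w_clause)
    apply (rule wp_While[where I = I and N = ?n and B = "\<lambda>_. 150"])
    subgoal using M by (auto simp: I_def less_imp_le less_imp_neq)
    subgoal premises p for i s'
    proof -
      have fr: "fst s' x_z = ?z" "snd s' y_\<sigma> = snd s y_\<sigma>" "snd s' y_X = snd s y_X"
        using p(2) by (simp_all add: agree_def)
      have i: "i < ?n" "fst s' x_a = off c + 1 + 2 * i" "fst s' x_r = ?n - i"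
          and M: "\<forall>x. snd s' y_M x \<le> ?z"
            "\<forall>x. snd s' y_M x = ?z \<longleftrightarrow> (\<exists>j < i. \<not> existential \<Phi> (var (C c ! j)) \<and> x = code (C c ! j))"
          and bad: "fst s' x_bad = 0 \<longleftrightarrow> fst s x_bad = 0 \<and> (\<forall>j < i. ?ok (C c ! j))"
        using p(1,3) by (auto simp: I_def)
      let ?l = "C c ! i"
      have code: "var ?l + var ?l + sgnl ?l = code ?l" by (simp add: code_def)
      note w = w_literal[OF c(1) i(1)] w_quantifier[OF var_less[OF c(1) i(1)]]
      show ?thesis
      proof (cases "existential \<Phi> (var ?l)")
        case True
        then show ?thesis using i w M bad fr
          by (auto simp: I_def wp_Seq less_Suc_eq)
      next
        case False
        have "(snd s' y_M)(code ?l := ?z) = (\<lambda>x. if x = code ?l then ?z else snd s' y_M x)" by auto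
        then show ?thesis using False i w M bad fr code
          by (auto simp: I_def wp_Seq less_Suc_eq)
      qed
    qed
    subgoal premises p for i t s'
    proof -
      have "i = ?n" using p(1,3) by (simp add: I_def)
      then show ?thesis
        using p(1,4) unfolding all_set_conv_all_nth[of "C c"] bex_set_conv_nth[of "C c"]
        by (simp add: I_def)
    qed
    done
qed

lemma wp_compare:
  assumes c: "c < m" "fst s x_a = off c"
    and M: "\<forall>x. snd s y_M x = fst s x_z \<longleftrightarrow> (\<exists>l' \<in> set ls. \<not> existential \<Phi> (var l') \<and> x = code l')"
  shows "wp w compare (\<lambda>t s'. t \<le> 200 * (length (C c) + 1) \<and>
    (fst s' x_bad = 0 \<longleftrightarrow> fst s x_bad = 0 \<and>
      (\<forall>l \<in> set (C c). \<forall>l' \<in> set ls. \<not> existential \<Phi> (var l) \<longrightarrow> var l' = var l \<longrightarrow>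
        sgnl l' \<noteq> sgnl l \<longrightarrow> \<not> var l < snd s y_D (fst s x_q)))) s"
proof -
  let ?n = "length (C c)" and ?z = "fst s x_z"
  let ?ok = "\<lambda>l. \<forall>l' \<in> set ls. \<not> existential \<Phi> (var l) \<longrightarrow> var l' = var l \<longrightarrow>
        sgnl l' \<noteq> sgnl l \<longrightarrow> \<not> var l < snd s y_D (fst s x_q)"
  define I where "I i s' \<longleftrightarrow> i \<le> ?n \<and> fst s' x_a = off c + 1 + 2 * i \<and> fst s' x_r = ?n - i \<and>
    (fst s' x_bad = 0 \<longleftrightarrow> fst s x_bad = 0 \<and> (\<forall>j < i. ?ok (C c ! j)))" for i and s' :: state
  show ?thesis
    unfolding compare_def
    apply (simp add: wp_Seq c w_clause)
    apply (rule wp_While[where I = I and N = ?n and B = "\<lambda>_. 150"])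
    subgoal by (auto simp: I_def)
    subgoal premises p for i s'
    proof -
      have fr: "fst s' x_z = ?z" "snd s' = snd s" "fst s' x_q = fst s x_q"
        using p(2) by (auto simp: agree_def)
      have i: "i < ?n" "fst s' x_a = off c + 1 + 2 * i" "fst s' x_r = ?n - i"
          and bad: "fst s' x_bad = 0 \<longleftrightarrow> fst s x_bad = 0 \<and> (\<forall>j < i. ?ok (C c ! j))"
        using p(1,3) by (auto simp: I_def)
      let ?l = "C c ! i"
      have "snd s y_M (2 * var ?l + 1 - sgnl ?l) = ?z \<longleftrightarrow>
          (\<exists>l' \<in> set ls. \<not> existential \<Phi> (var l') \<and> code l' = 2 * var ?l + 1 - sgnl ?l)"
        unfolding M[rule_format] by metis
      also have "\<dots> \<longleftrightarrow>
          (\<exists>l' \<in> set ls. \<not> existential \<Phi> (var l') \<and> var l' = var ?l \<and> sgnl l' \<noteq> sgnl ?l)"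
        by (simp only: code_complement)
      finally have m: "snd s y_M (Suc (var ?l + var ?l) - sgnl ?l) = ?z \<longleftrightarrow>
          (\<exists>l' \<in> set ls. \<not> existential \<Phi> (var l') \<and> var l' = var ?l \<and> sgnl l' \<noteq> sgnl ?l)"
        by (simp add: mult_2)
      have ok: "?ok ?l \<longleftrightarrow> snd s y_M (Suc (var ?l + var ?l) - sgnl ?l) = ?z \<longrightarrow>
          \<not> var ?l < snd s y_D (fst s x_q)"
        unfolding m by metis
      note w = w_literal[OF c(1) i(1)]
      have "I (Suc i) s'' \<longleftrightarrow> fst s'' x_a = off c + 3 + 2 * i \<and> fst s'' x_r = ?n - Suc i \<and>
          (fst s'' x_bad = 0 \<longleftrightarrow> fst s' x_bad = 0 \<and> ?ok ?l)" for s''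
        unfolding I_def bad less_Suc_eq using i by auto
      then show ?thesis using i w fr unfolding ok
        by (simp add: wp_Seq)
    qed
    subgoal premises p for i t s'
    proof -
      have "i = ?n" using p(1,3) by (simp add: I_def)
      then show ?thesis
        using p(1,4) unfolding all_set_conv_all_nth[of "C c"] by (simp add: I_def)
    qed
    done
qed

end

definition check_row :: com where
  "check_row =
     While (Minus (Var x_K) (Var x_t))
       (Assign x_a (Arr y_ptr (Arr y_T (Var x_t))) ;; compare ;; Incr x_t 1 ;; Incr x_q 1)"

lemma mods_check_row [simp]:
  "mods check_row = {x_a, x_r, x_b, x_v, x_bad, x_t, x_q}" "amods check_row = {}"
  by (auto simp: check_row_def)

text \<open>All rows are completed even after a failure. This costs nothing in the worst case and
  lets the counter in \<open>y_\<sigma>\<close> wrap around to 0 for the next tuple.\<close>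

definition check :: com where
  "check =
     Assign x_bad (Num 0) ;; Assign x_q (Num 0) ;; Assign x_s (Num 0) ;;
     While (Minus (Var x_K) (Var x_s))
       (Incr x_z 1 ;; Assign x_a (Arr y_ptr (Arr y_T (Var x_s))) ;; mark ;;
        Assign x_t (Num 0) ;; check_row ;; increment y_\<sigma> (Num 2) x_k ;; Incr x_s 1)"

lemma mods_check [simp]:
  "mods check = {x_bad, x_q, x_s, x_z, x_a, x_r, x_b, x_v, x_f, x_t, x_j}"
  "amods check = {y_M, y_\<sigma>}"
  by (auto simp: check_def)

definition enumerate :: com where
  "enumerate =
     Assign x_go (Num 1) ;;
     While (Var x_go)
       (check ;;
        If (Var x_bad)
          (increment y_T (Var x_m) x_K ;;
           If (Neq (Var x_j) (Var x_K)) Skip (Assign x_go (Num 0) ;; Assign x_res (Num 1)))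
          (Assign x_go (Num 0) ;; Assign x_res (Num 0)))"

lemma refuting_cong:
  assumes "\<And>s. s < 2 ^ k \<Longrightarrow> T s = T' s"
  shows "refuting \<Phi> k E X T \<longleftrightarrow> refuting \<Phi> k E X T'"
  using assms unfolding refuting_def falsified_def consistent_def by simp

context formula
begin

lemma wp_check_row:
  assumes K: "fst s x_K = 2 ^ fst s x_k"
    and ptr: "\<forall>c < m. snd s y_ptr c = off c"
    and D: "\<forall>p < fst s x_K * fst s x_K.
      entry (fst s x_k) (snd s y_E) (snd s y_D p) (p div fst s x_K) (p mod fst s x_K)"
    and T: "\<forall>i < fst s x_K. snd s y_T i < m"
    and d: "\<forall>C \<in> set (matrix \<Phi>). length C \<le> d"
    and s: "fst s x_s < fst s x_K" "fst s x_t = 0" "fst s x_q = fst s x_s * fst s x_K"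
    and M: "\<forall>x. snd s y_M x = fst s x_z \<longleftrightarrow>
      (\<exists>l' \<in> set (C (snd s y_T (fst s x_s))). \<not> existential \<Phi> (var l') \<and> x = code l')"
  shows "wp w check_row (\<lambda>t s'. t \<le> fst s x_K * (300 * (d + 1)) + 10 \<and>
    fst s' x_q = Suc (fst s x_s) * fst s x_K \<and>
    (fst s' x_bad = 0 \<longleftrightarrow> fst s x_bad = 0 \<and> (\<forall>t < fst s x_K.
      consistent \<Phi> (fst s x_k) (snd s y_E) (snd s y_X) (snd s y_T) (fst s x_s) t))) s"
proof -
  let ?k = "fst s x_k" and ?K = "fst s x_K" and ?s = "fst s x_s"
  let ?con = "consistent \<Phi> ?k (snd s y_E) (snd s y_X) (snd s y_T) ?s"
  define I where "I i s' \<longleftrightarrow> i \<le> ?K \<and> fst s' x_t = i \<and> fst s' x_q = ?s * ?K + i \<and>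
    (fst s' x_bad = 0 \<longleftrightarrow> fst s x_bad = 0 \<and> (\<forall>t < i. ?con t))" for i and s' :: state
  show ?thesis
    unfolding check_row_def
    apply (rule wp_While[where I = I and N = ?K and B = "\<lambda>_. 300 * (d + 1)"])
    subgoal using s by (simp add: I_def)
    subgoal premises p for i s'
    proof -
      have fr: "fst s' x_K = ?K" "snd s' = snd s" "fst s' x_z = fst s x_z"
        using p(2) by (auto simp: agree_def)
      have i: "i < ?K" "fst s' x_t = i" "fst s' x_q = ?s * ?K + i"
          and bad: "fst s' x_bad = 0 \<longleftrightarrow> fst s x_bad = 0 \<and> (\<forall>t < i. ?con t)"
        using p(1,3) fr by (auto simp: I_def)
      let ?c = "snd s y_T i"
      have c: "?c < m" "snd s y_ptr ?c = off ?c" "length (C ?c) \<le> d" using T ptr d i(1) by auto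
      have "?s * ?K + i < Suc ?s * ?K" using i(1) by simp
      also have "\<dots> \<le> ?K * ?K" using s(1) by (intro mult_le_mono1) simp
      finally have "entry ?k (snd s y_E) (snd s y_D (?s * ?K + i)) ?s i"
        using D i(1) by force
      then have D': "\<not> v < snd s y_D (?s * ?K + i) \<longleftrightarrow>
          (\<exists>j < ?k. snd s y_E j \<le> v \<and> digit 2 ?s j \<noteq> digit 2 i j)" if "v < n" for v
        using that unfolding entry_def by blast
      have con: "?con i \<longleftrightarrow> (\<forall>l \<in> set (C ?c). \<forall>l' \<in> set (C (snd s y_T ?s)).
          \<not> existential \<Phi> (var l) \<longrightarrow> var l' = var l \<longrightarrow> sgnl l' \<noteq> sgnl l \<longrightarrow>
          \<not> var l < snd s y_D (?s * ?K + i))"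
        unfolding consistent_def
        by (intro ball_cong refl) (use D' var_less[OF c(1)] in \<open>auto simp: in_set_conv_nth\<close>)
      show ?thesis
        apply (simp add: wp_Seq i c fr)
        apply (rule wp_mono[OF wp_compare[where c = ?c and ls = "C (snd s y_T ?s)"]])
        using c fr M i apply (simp_all)
        subgoal premises p1 for t1 s1
        proof -
          have "fst s1 x_t = i" "fst s1 x_q = ?s * ?K + i" using p1 fr i by (auto simp: agree_def)
          moreover have "fst s1 x_bad = 0 \<longleftrightarrow> fst s x_bad = 0 \<and> (\<forall>t < Suc i. ?con t)"
            using p1(2) fr i bad con by (auto simp: less_Suc_eq)
          ultimately show ?thesis using p1(2) c i by (simp add: I_def wp_Seq)
        qed
        done
    qed
    subgoal premises p for i t s'
    proof -
      have "fst s' x_K = ?K" using p(2) by (simp add: agree_def)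
      then have "i = ?K" using p(1,3) by (simp add: I_def)
      then show ?thesis using p(1,4) by (simp add: I_def)
    qed
    done
qed

lemma wp_check:
  assumes K: "fst s x_K = 2 ^ fst s x_k"
    and ptr: "\<forall>c < m. snd s y_ptr c = off c"
    and D: "\<forall>p < fst s x_K * fst s x_K.
      entry (fst s x_k) (snd s y_E) (snd s y_D p) (p div fst s x_K) (p mod fst s x_K)"
    and T: "\<forall>i < fst s x_K. snd s y_T i < m"
    and d: "\<forall>C \<in> set (matrix \<Phi>). length C \<le> d"
    and \<sigma>: "\<forall>j < fst s x_k. snd s y_\<sigma> j = 0"
    and L: "listing (fst s x_k) (snd s y_E) (snd s y_X) (occurring \<Phi>)"
    and M: "\<forall>x. snd s y_M x \<le> fst s x_z"
  shows "wp w check (\<lambda>t s'. t \<le> 2000 * fst s x_K * fst s x_K * (d + 1) \<and>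
    (\<forall>j < fst s x_k. snd s' y_\<sigma> j = 0) \<and> (\<forall>x. snd s' y_M x \<le> fst s' x_z) \<and>
    (fst s' x_bad = 0 \<longleftrightarrow>
      refuting \<Phi> (fst s x_k) (snd s y_E) (snd s y_X) (snd s y_T))) s"
proof -
  let ?k = "fst s x_k" and ?K = "fst s x_K" and ?E = "snd s y_E" and ?X = "snd s y_X"
    and ?T = "snd s y_T"
  let ?ok = "\<lambda>i. falsified \<Phi> ?X ?T i \<and> (\<forall>t < ?K. consistent \<Phi> ?k ?E ?X ?T i t)"
  define I where "I i s' \<longleftrightarrow> i \<le> ?K \<and> fst s' x_s = i \<and> fst s' x_q = i * ?K \<and>
    (\<forall>j < ?k. snd s' y_\<sigma> j = digit 2 i j) \<and> (\<forall>x. snd s' y_M x \<le> fst s' x_z) \<and>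
    (fst s' x_bad = 0 \<longleftrightarrow> (\<forall>j < i. ?ok j))" for i and s' :: state
  \<comment> \<open>Lets the budget of a row pay for incrementing the \<open>?k\<close> digits of
    the assignment.\<close>
  have kK: "?k + 1 \<le> ?K" using K by (simp add: Suc_leI)
  show ?thesis
    unfolding check_def
    apply (simp add: wp_Seq)
    apply (rule wp_While[where I = I and N = ?K and B = "\<lambda>_. 1500 * (?K * (d + 1))"])
    subgoal using \<sigma> M by (simp add: I_def digit_0)
    subgoal premises p for i s'
    proof -
      have fr: "fst s' x_k = ?k" "fst s' x_K = ?K" "snd s' y_E = ?E" "snd s' y_X = ?X"
          "snd s' y_T = ?T" "snd s' y_ptr = snd s y_ptr" "snd s' y_D = snd s y_D"
        using p(2) by (simp_all add: agree_def)
      have i: "i < ?K" "fst s' x_s = i" "fst s' x_q = i * ?K"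
          "\<forall>j < ?k. snd s' y_\<sigma> j = digit 2 i j" "\<forall>x. snd s' y_M x \<le> fst s' x_z"
          and bad: "fst s' x_bad = 0 \<longleftrightarrow> (\<forall>j < i. ?ok j)"
        using p(1,3) fr by (auto simp: I_def)
      let ?c = "?T i"
      have c: "?c < m" "snd s y_ptr ?c = off ?c" "length (C ?c) \<le> d" using T ptr d i(1) by auto
      have X: "?X (var l) - 1 < ?k" if "l \<in> set (C ?c)" "existential \<Phi> (var l)" for l
      proof -
        have "C ?c \<in> set (matrix \<Phi>)" using c(1) by simp
        then have "var l \<in> occurring \<Phi>" using that unfolding occurring_def by blast
        then show ?thesis using L by (force simp: listing_def)
      qed
      have fal: "falsified \<Phi> ?X ?T i \<longleftrightarrow> (\<forall>l \<in> set (C ?c). existential \<Phi> (var l) \<longrightarrow>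
          snd s' y_\<sigma> (?X (var l) - 1) \<noteq> sgnl l)"
        unfolding falsified_def by (intro ball_cong refl) (use X i(4) in auto)
      show ?thesis
        apply (simp add: wp_Seq i c fr)
        apply (rule wp_mono[OF wp_mark[where c = ?c]])
        using c fr i apply (simp_all add: le_imp_less_Suc)
        subgoal premises p1 for t1 s1
        proof -
          have fr1: "fst s1 x_s = i" "fst s1 x_k = ?k" "fst s1 x_K = ?K" "fst s1 x_q = i * ?K"
              "snd s1 y_\<sigma> = snd s' y_\<sigma>" "fst s1 x_z = Suc (fst s' x_z)" "snd s1 y_E = ?E"
              "snd s1 y_X = ?X" "snd s1 y_T = ?T" "snd s1 y_ptr = snd s y_ptr"
              "snd s1 y_D = snd s y_D"
            using p1 fr i by (auto simp: agree_def)
          have bad1: "fst s1 x_bad = 0 \<longleftrightarrow> (\<forall>j < i. ?ok j) \<and> falsified \<Phi> ?X ?T i"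
            using p1(2) fal bad by simp
          show ?thesis
            apply (simp add: wp_Seq)
            apply (rule wp_mono[OF wp_check_row[where d = d]])
            subgoal using K fr1 by simp
            subgoal using ptr fr1 by simp
            subgoal using D fr1 by simp
            subgoal using T fr1 by simp
            subgoal using d .
            subgoal using i(1) fr1 by simp
            subgoal by simp
            subgoal using fr1 by simp
            subgoal using p1(2) fr1 by simp
            subgoal premises p2 for t2 s2
            proof -
              have fr2: "fst s2 x_s = i" "fst s2 x_k = ?k" "fst s2 x_z = Suc (fst s' x_z)"
                  "snd s2 y_\<sigma> = snd s' y_\<sigma>" "snd s2 y_M = snd s1 y_M"
                using p2(1) fr1 by (auto simp: agree_def)
              have bad2: "fst s2 x_bad = 0 \<longleftrightarrow> (\<forall>j < Suc i. ?ok j)"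
                using p2(2) fr1 K bad1 by (auto simp: less_Suc_eq)
              show ?thesis
                apply (simp add: wp_Seq)
                apply (rule wp_mono[OF wp_increment[where b = 2 and x = i]])
                using i K fr2 apply (simp_all)
                subgoal premises p3 for t3 s3
                proof -
                  have "fst s3 x_s = i" "fst s3 x_bad = fst s2 x_bad" "fst s3 x_q = fst s2 x_q"
                      "fst s3 x_z = fst s2 x_z" "snd s3 y_M = snd s2 y_M"
                    using p3(1) fr2 by (auto simp: agree_def)
                  moreover have "t1 + t2 + t3 + 100 \<le> 1500 * (?K * (d + 1))"
                  proof -
                    define u where "u = ?K * (d + 1)"
                    have "t1 \<le> 200 * (d + 1)" using p1(2) c(3) by simp
                    moreover have "t2 \<le> 300 * u + 10"
                      using p2(2) fr1 by (simp add: u_def algebra_simps)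
                    moreover have "t3 \<le> 121 * (?k + 2)" using p3(2) by simp
                    moreover have "1 * (d + 1) \<le> u"
                      unfolding u_def using kK by (intro mult_le_mono1) simp
                    moreover have "?K * 1 \<le> u" unfolding u_def by (intro mult_le_mono2) simp
                    ultimately have "t1 + t2 + t3 + 100 \<le> 1500 * u" using kK by simp
                    then show ?thesis by (simp add: u_def)
                  qed
                  ultimately show ?thesis
                    using p3(2) p2(2) p1(2) bad2 i fr1 fr2 K by (simp add: I_def)
                qed
                done
            qed
            done
        qed
        done
    qed
    subgoal premises p for i t s'
    proof -
      have "fst s' x_K = ?K" using p(2) by (simp add: agree_def)
      then have "i = ?K" using p(1,3) by (simp add: I_def)
      moreover have "9 + t \<le> 2000 * ?K * ?K * (d + 1)"
      proof -
        define u where "u = ?K * (?K * (d + 1))"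
        have "1 * (1 * 1) \<le> u"
          using kK unfolding u_def by (intro mult_le_mono) auto
        moreover have "t \<le> 1500 * u + 7" using p(4) by (simp add: u_def algebra_simps)
        ultimately have "9 + t \<le> 2000 * u" by simp
        then show ?thesis by (simp only: u_def mult.assoc)
      qed
      ultimately show ?thesis
        using p(1) K digit_overflow[of 2 _ ?k] by (simp add: I_def refuting_def)
    qed
    done
qed

text \<open>Turns the search for a tuple into counting: every tuple of clause indices is the digit
  sequence of a number below \<open>m ^ 2 ^ k\<close>.\<close>

lemma qcnf_false_iff_digits:
  assumes "listing k E X (occurring \<Phi>)" "0 < m"
  shows "\<not> qcnf_true \<Phi> \<longleftrightarrow> (\<exists>x < m ^ 2 ^ k. refuting \<Phi> k E X (digit m x))"
proof
  assume "\<not> qcnf_true \<Phi>"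
  then obtain T where T: "\<forall>s < 2 ^ k. T s < m" "refuting \<Phi> k E X T"
    using qcnf_false_iff[OF wf assms(1)] by blast
  then obtain x where "x < m ^ 2 ^ k" "\<forall>s < 2 ^ k. digit m x s = T s"
    using ex_digits[of "2 ^ k" T m] by blast
  then show "\<exists>x < m ^ 2 ^ k. refuting \<Phi> k E X (digit m x)"
    using T(2) refuting_cong[of k "digit m x" T \<Phi> E X] by blast
next
  assume "\<exists>x < m ^ 2 ^ k. refuting \<Phi> k E X (digit m x)"
  then show "\<not> qcnf_true \<Phi>"
    using qcnf_false_iff[OF wf assms(1)] digit_less[OF assms(2)] by blast
qed

lemma wp_enumerate:
  assumes K: "fst s x_K = 2 ^ fst s x_k" and m: "fst s x_m = m" "0 < m"
    and ptr: "\<forall>c < m. snd s y_ptr c = off c"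
    and D: "\<forall>p < fst s x_K * fst s x_K.
      entry (fst s x_k) (snd s y_E) (snd s y_D p) (p div fst s x_K) (p mod fst s x_K)"
    and T: "\<forall>i < fst s x_K. snd s y_T i = 0"
    and d: "\<forall>C \<in> set (matrix \<Phi>). length C \<le> d"
    and \<sigma>: "\<forall>j < fst s x_k. snd s y_\<sigma> j = 0"
    and L: "listing (fst s x_k) (snd s y_E) (snd s y_X) (occurring \<Phi>)"
    and M: "\<forall>x. snd s y_M x \<le> fst s x_z"
  shows "wp w enumerate
    (\<lambda>t s'. t \<le> 3000 * (m ^ fst s x_K * (fst s x_K * fst s x_K * (d + 1))) + 10 \<and>
      fst s' x_res = of_bool (qcnf_true \<Phi>)) s"
proof -
  let ?k = "fst s x_k" and ?K = "fst s x_K" and ?E = "snd s y_E" and ?X = "snd s y_X"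
  let ?ref = "\<lambda>x. refuting \<Phi> ?k ?E ?X (digit m x)"
  have true_iff: "qcnf_true \<Phi> \<longleftrightarrow> (\<forall>x < m ^ ?K. \<not> ?ref x)"
    using qcnf_false_iff_digits[OF L m(2)] K by auto
  define I where "I i s' \<longleftrightarrow>
    (if fst s' x_go = 0 then fst s' x_res = of_bool (qcnf_true \<Phi>)
     else i < m ^ ?K \<and> (\<forall>j < ?K. snd s' y_T j = digit m i j) \<and>
       (\<forall>j < ?k. snd s' y_\<sigma> j = 0) \<and> (\<forall>x. snd s' y_M x \<le> fst s' x_z) \<and> (\<forall>x < i. \<not> ?ref x))"
    for i and s' :: state
  have K1: "1 \<le> ?K" using K by simp
  \<comment> \<open>\<open>u\<close> is the order of one check, with \<open>d + 1\<close> because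
    even an empty clause takes time. \<open>?K \<le> u\<close> absorbs incrementing the
    \<open>?K\<close> digits of the tuple.\<close>
  define u where "u = ?K * ?K * (d + 1)"
  have u: "?K \<le> u" "1 \<le> u"
  proof -
    have "?K * 1 * 1 \<le> u" "1 * 1 * 1 \<le> u"
      unfolding u_def using K1 by (intro mult_le_mono; simp)+
    then show "?K \<le> u" "1 \<le> u" by simp_all
  qed
  show ?thesis
    unfolding enumerate_def
    apply (simp add: wp_Seq split del: split_of_bool)
    apply (rule wp_While[where I = I and N = "m ^ ?K" and B = "\<lambda>_. 3000 * u"])
    subgoal using T \<sigma> M m(2) by (simp add: I_def digit_0)
    subgoal premises p for i s'
    proof -
      have fr: "fst s' x_k = ?k" "fst s' x_K = ?K" "snd s' y_E = ?E" "snd s' y_X = ?X"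
          "snd s' y_ptr = snd s y_ptr" "snd s' y_D = snd s y_D" "fst s' x_m = m"
        using p(2) m(1) by (simp_all add: agree_def)
      have go: "fst s' x_go \<noteq> 0" using p(3) by simp
      have i: "i < m ^ ?K" "\<forall>j < ?K. snd s' y_T j = digit m i j"
          "\<forall>j < ?k. snd s' y_\<sigma> j = 0" "\<forall>x. snd s' y_M x \<le> fst s' x_z" "\<forall>x < i. \<not> ?ref x"
        using p(1) go by (auto simp: I_def)
      have ref: "refuting \<Phi> ?k ?E ?X (snd s' y_T) \<longleftrightarrow> ?ref i"
        using i(2) K by (intro refuting_cong) simp
      show ?thesis
        apply (simp add: wp_Seq i)
        apply (rule wp_mono[OF wp_check[where d = d]])
        subgoal using K fr by simp
        subgoal using ptr fr by simp
        subgoal using D fr by simp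
        subgoal using i(2) fr digit_less[OF m(2)] by simp
        subgoal using d .
        subgoal using i(3) fr by simp
        subgoal using L fr by simp
        subgoal using i(4) .
        subgoal premises p1 for t1 s1
        proof -
          have fr1: "fst s1 x_K = ?K" "snd s1 y_T = snd s' y_T" "fst s1 x_m = m" "fst s1 x_go \<noteq> 0"
            using p1(1) fr go by (simp_all add: agree_def)
          have t1: "t1 \<le> 2000 * u" using p1(2) fr by (simp add: u_def mult.assoc)
          have bad: "fst s1 x_bad = 0 \<longleftrightarrow> ?ref i" using p1(2) fr ref by simp
          show ?thesis
          proof (cases "?ref i")
            case True
            then have "\<not> qcnf_true \<Phi>" using true_iff i(1) by blast
            then show ?thesis using True bad t1 u by (simp add: wp_Seq I_def)
          next
            case False
            then have b: "fst s1 x_bad \<noteq> 0" using bad by simp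
            show ?thesis
              using b apply (simp add: wp_Seq)
              apply (rule wp_mono[OF wp_increment[where b = m and x = i]])
              subgoal using i(2) fr1 by simp
              subgoal using i(1) fr1 by simp
              subgoal using m(2) .
              subgoal by simp
              subgoal by simp
              subgoal using fr1 by simp
              subgoal premises p2 for t2 s2
              proof -
                have fr2: "fst s2 x_K = ?K" "fst s2 x_z = fst s1 x_z" "snd s2 y_M = snd s1 y_M"
                    "snd s2 y_\<sigma> = snd s1 y_\<sigma>" "fst s2 x_go \<noteq> 0"
                  using p2(2) fr1 by (simp_all add: agree_def)
                have t2: "t2 \<le> 134 * (?K + 2)" using p2(3) fr1 by simp
                have dig: "\<forall>j < ?K. snd s2 y_T j = digit m (Suc i) j"
                    "fst s2 x_j = ?K \<longleftrightarrow> Suc i = m ^ ?K"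
                  using p2(3) fr1 by auto
                have nref: "\<forall>x < Suc i. \<not> ?ref x" using i(5) False by (auto simp: less_Suc_eq)
                show ?thesis
                proof (cases "Suc i = m ^ ?K")
                  case True
                  then have "qcnf_true \<Phi>" using true_iff nref by simp
                  then show ?thesis using True i(1) dig fr2 t1 t2 u by (simp add: wp_Seq I_def)
                next
                  case False
                  then have "Suc i < m ^ ?K" using i(1) by simp
                  then show ?thesis using False i(1) dig fr fr2 nref t1 t2 u p1(2)
                    by (simp add: wp_Seq I_def)
                qed
              qed
              done
          qed
        qed
        done
    qed
    subgoal premises p for i t s'
      using p(1,3,4) by (simp add: I_def u_def algebra_simps)
    done
qed

end

text \<open>
  Without existential variables or with at most one clause, the time bound leaves no room for the
  table; but then the answer is immediate.
\<close>

definition decide :: com where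
  "decide =
     Read x_n (Num 0) ;; Read x_m (Plus (Var x_n) (Num 1)) ;;
     Assign x_a (Plus (Var x_n) (Num 2)) ;; collect ;;
     If (Var x_m)
       (If (Var x_k)
         (If (Minus (Var x_m) (Num 1))
           (power_of_two ;; table ;; enumerate)
           (Assign x_res (Num 1)))
         (Assign x_res (Num 0)))
       (Assign x_res (Num 1))"

lemma mods_collect [simp]:
  "mods collect = {x_v, x_q, x_k, x_a, x_r, x_c}" "amods collect = {y_ptr, y_E, y_X}"
  by (auto simp: collect_def)

lemma mods_table [simp]:
  "mods table = {x_g, x_j, x_q, x_f, x_t, x_s}" "amods table = {y_D, y_\<sigma>, y_\<tau>}"
  by (auto simp: table_def)

context formula
begin

lemma true_if_no_clauses:
  assumes "listing k E X (occurring \<Phi>)" "m = 0"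
  shows "qcnf_true \<Phi>"
  using qcnf_false_iff[OF wf assms(1)] assms(2) by (metis less_zeroE pos2 zero_less_power)

text \<open>A clause with only universal literals and no complementary pair is falsified by the
  universal player outright, so a constant tuple refutes.\<close>

lemma false_if_universal:
  assumes L: "listing 0 E X (occurring \<Phi>)" and m: "0 < m"
  shows "\<not> qcnf_true \<Phi>"
proof -
  have C: "C 0 \<in> set (matrix \<Phi>)" using m by simp
  have "\<not> existential \<Phi> (var l)" if "l \<in> set (C 0)" for l
  proof
    assume "existential \<Phi> (var l)"
    then have "var l \<in> occurring \<Phi>" using C that unfolding occurring_def by blast
    then show False using L by (force simp: listing_def)
  qed
  then have "falsified \<Phi> X (\<lambda>_. 0) s" for s by (simp add: falsified_def)
  moreover have "consistent \<Phi> 0 E X (\<lambda>_. 0) s t" for s t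
  proof -
    have "\<not> (var l' = var l \<and> sgnl l' \<noteq> sgnl l)" if "l \<in> set (C 0)" "l' \<in> set (C 0)" for l l'
    proof -
      have "\<forall>i. \<not> (Pos i \<in> set (C 0) \<and> Neg i \<in> set (C 0))"
        using wf C unfolding wf_qcnf_def by blast
      then show ?thesis using that by (cases l; cases l') auto
    qed
    then show ?thesis unfolding consistent_def by blast
  qed
  ultimately show ?thesis
    using qcnf_false_iff[OF wf L] m by (auto simp: refuting_def intro!: exI[of _ "\<lambda>_. 0"])
qed

text \<open>The only clause contains an existential literal, and the existential player makes it
  true.\<close>

lemma true_if_single_clause:
  assumes L: "listing k E X (occurring \<Phi>)" and m: "m = 1" and k: "0 < k"
  shows "qcnf_true \<Phi>"
proof (rule ccontr)
  assume "\<not> qcnf_true \<Phi>"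
  then obtain T where T: "\<forall>s < 2 ^ k. T s < 1" "refuting \<Phi> k E X T"
    using qcnf_false_iff[OF wf L] m by auto
  have E: "E 0 \<in> occurring \<Phi>" "X (E 0) = 1" using L k by (auto simp: listing_def)
  then obtain D l where l: "D \<in> set (matrix \<Phi>)" "l \<in> set D" "var l = E 0" "existential \<Phi> (E 0)"
    unfolding occurring_def by blast
  have "D = C 0" using l(1) m by (auto simp: in_set_conv_nth)
  \<comment> \<open>The lowest binary digit of the number \<open>sgnl l\<close> is
    \<open>sgnl l\<close> itself, and this digit is the value of \<open>E 0\<close>; so the
    assignment with this number satisfies \<open>l\<close>.\<close>
  have s: "sgnl l < 2 ^ k"
    using sgnl_cases[of l] one_less_power[OF _ k, of "2 :: nat"] by auto
  then have "T (sgnl l) = 0" using T(1) by blast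
  then have "l \<in> set (C (T (sgnl l)))" using l(2) \<open>D = C 0\<close> by simp
  moreover have "falsified \<Phi> X T (sgnl l)" using T(2) s unfolding refuting_def by blast
  ultimately have "digit 2 (sgnl l) 0 \<noteq> sgnl l"
    using l(3,4) E(2) unfolding falsified_def by force
  then show False using sgnl_cases[of l] by (auto simp: digit_def)
qed

lemma wp_decide:
  assumes d: "\<forall>C \<in> set (matrix \<Phi>). length C \<le> d"
  defines "k \<equiv> card (occurring \<Phi>)"
  shows "wp w decide (\<lambda>t s'. t \<le> 300 * matrix_size \<Phi> +
      (if 2 \<le> m \<and> 0 < k then 50 * (k + 1) + 1000 * 2 ^ k * 2 ^ k * (k + 2) +
        3000 * (m ^ 2 ^ k * (2 ^ k * 2 ^ k * (d + 1))) else 0) \<and>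
    fst s' x_res = of_bool (qcnf_true \<Phi>)) (start w)"
proof -
  have size: "1 \<le> matrix_size \<Phi>" by (simp add: matrix_size_def enc_matrix_def)
  have w: "w \<noteq> []" by (simp add: enc_qcnf_def)
  show ?thesis
    unfolding decide_def
    apply (simp add: w wp_Seq w_0 w_m start_def split del: split_of_bool if_split)
    apply (rule wp_mono[OF wp_collect])
    apply (simp_all split del: split_of_bool if_split)
    subgoal premises p for t1 s1
    proof -
      have L: "listing (fst s1 x_k) (snd s1 y_E) (snd s1 y_X) (occurring \<Phi>)"
          and ptr: "\<forall>c < m. snd s1 y_ptr c = off c" and t1: "t1 \<le> 200 * matrix_size \<Phi>"
        using p(2) by auto
      have k: "fst s1 x_k = k" using listing_card[OF L] by (simp add: k_def)
      have fr: "fst s1 x_n = n" "fst s1 x_m = m" "fst s1 x_z = 0" "snd s1 y_\<sigma> = (\<lambda>_. 0)"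
          "snd s1 y_\<tau> = (\<lambda>_. 0)" "snd s1 y_T = (\<lambda>_. 0)" "snd s1 y_M = (\<lambda>_. 0)"
        using p(1) by (auto simp: agree_def)
      consider "m = 0" | "0 < m" "k = 0" | "m = 1" "0 < k" | "2 \<le> m" "0 < k" by linarith
      then show ?thesis
      proof cases
        case 1
        then show ?thesis using true_if_no_clauses[OF L] fr t1 size by simp
      next
        case 2
        then show ?thesis using false_if_universal[of "snd s1 y_E" "snd s1 y_X"] L k fr t1 size by simp
      next
        case 3
        then show ?thesis using true_if_single_clause[OF L] k fr t1 size by simp
      next
        case 4
        let ?B = "1000 * 2 ^ k * 2 ^ k * (k + 2)"
        have ne: "matrix \<Phi> \<noteq> []" using 4 by auto
        show ?thesis
          using 4 apply (simp add: fr k ne wp_Seq split del: split_of_bool)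
          apply (rule wp_mono[OF wp_power_of_two])
          subgoal premises p2 for t2 s2
          proof -
            have fr2: "fst s2 x_n = n" "fst s2 x_m = m" "fst s2 x_z = 0" "fst s2 x_k = k"
                "fst s2 x_K = 2 ^ k" "snd s2 = snd s1" "t2 \<le> 50 * (k + 1)"
              using p2 fr k by (auto simp: agree_def)
            show ?thesis
              unfolding wp_Seq
              apply (rule wp_mono[OF wp_table])
              subgoal using fr2 by simp
              subgoal using fr2 by simp
              subgoal using fr fr2 by simp
              subgoal using fr fr2 by simp
              subgoal premises p3 for t3 s3
              proof -
                have fr3: "fst s3 x_m = m" "fst s3 x_z = 0" "fst s3 x_k = k" "fst s3 x_K = 2 ^ k"
                    "snd s3 y_E = snd s1 y_E" "snd s3 y_X = snd s1 y_X" "snd s3 y_T = (\<lambda>_. 0)"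
                    "snd s3 y_M = (\<lambda>_. 0)" "snd s3 y_ptr = snd s1 y_ptr"
                  using p3(1) fr fr2 by (auto simp: agree_def)
                have p3': "t3 \<le> ?B" "\<forall>j < k. snd s3 y_\<sigma> j = 0"
                    "\<forall>p < 2 ^ k * 2 ^ k. entry k (snd s1 y_E) (snd s3 y_D p) (p div 2 ^ k) (p mod 2 ^ k)"
                  using p3(2) fr2 by auto
                show ?thesis
                  apply (rule wp_mono[OF wp_enumerate[where d = d]])
                  subgoal using fr3 by simp
                  subgoal using fr3 by simp
                  subgoal using ne by simp
                  subgoal using fr3 ptr by simp
                  subgoal using fr3 p3'(3) by simp
                  subgoal using fr3 by simp
                  subgoal using d .
                  subgoal using fr3 p3'(2) by simp
                  subgoal using fr3 L k by simp
                  subgoal using fr3 by simp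
                  subgoal premises p4 for t4 s4
                  proof -
                    have "t4 \<le> 3000 * (m ^ 2 ^ k * (2 ^ k * 2 ^ k * (d + 1))) + 10"
                        "fst s4 x_res = of_bool (qcnf_true \<Phi>)"
                      using p4(2) fr3 by auto
                    then show ?thesis
                      using t1 fr2(7) p3'(1) size 4 by simp
                  qed
                  done
              qed
              done
          qed
          done
      qed
    qed
    done
qed

end

section \<open>Estimates: the cost of the procedure against the claimed bound\<close>

lemma cube_le: "n * n * n \<le> 4 * 2 ^ n" for n :: nat
proof (induction n rule: less_induct)
  case (less n)
  show ?case
  proof (cases "n \<le> 4")
    case True
    then have "n \<in> {0, 1, 2, 3, 4}" by auto
    then show ?thesis by auto
  next
    case False
    then obtain l where n: "n = Suc l" "4 \<le> l" by (cases n) auto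
    \<comment> \<open>From 4 on, each step at most doubles the cube; the factor 4 of the claim is
      attained at \<open>n = 4\<close>.\<close>
    have "n * n * n = l * l * l + 3 * (l * l) + 3 * l + 1" using n(1) by (simp add: algebra_simps)
    moreover have "4 * (l * l) \<le> l * l * l" "4 * l \<le> l * l" using n(2) by simp_all
    ultimately have "n * n * n \<le> 2 * (l * l * l)" using n(2) by linarith
    then show ?thesis using less[of l] n by simp
  qed
qed

text \<open>Each assumption pays for one excess: \<open>2 \<le> m\<close> gives
  \<open>2 ^ K \<le> m ^ K\<close>, which dominates the table, of order at most
  \<open>K ^ 3\<close>; \<open>0 < k\<close> gives \<open>K * K \<le> 4 * (K choose 2)\<close>, so
  that ordered pairs fit the binomial coefficient; \<open>0 < d\<close> gives
  \<open>d + 1 \<le> 2 * d\<close>.\<close>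

lemma time_bound:
  fixes k m d :: nat
  assumes "2 \<le> m" "0 < k" "0 < d"
  shows "50 * (k + 1) + 1000 * 2 ^ k * 2 ^ k * (k + 2) + 3000 * (m ^ 2 ^ k * (2 ^ k * 2 ^ k * (d + 1)))
    \<le> 33000 * (m ^ (2 ^ k) * d * ((2 ^ k) choose 2))"
proof -
  define K :: nat where "K = 2 ^ k"
  define P where "P = m ^ K"
  define b where "b = K choose 2"
  have K: "k + 1 \<le> K" "2 \<le> K"
    using assms(2) self_le_power[of 2 k] by (auto simp: K_def Suc_leI)
  have "2 ^ K \<le> P" unfolding P_def using assms(1) by (rule power_mono) simp
  have "even (K * (K - 1))" by (cases K) auto
  then have "2 * b = K * (K - 1)" by (simp add: b_def choose_two)
  moreover have "K * K \<le> K * (2 * (K - 1))" using K(2) by (intro mult_le_mono2) linarith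
  moreover have "K * (2 * (K - 1)) = 2 * (K * (K - 1))" by (rule mult.left_commute)
  ultimately have b: "K * K \<le> 4 * b" by linarith
  have b1: "1 \<le> b" using b K(2) by (cases b) auto
  have "K * K * (k + 2) \<le> K * K * (2 * K)" using K by (intro mult_le_mono2) simp
  also have "\<dots> \<le> 8 * P" using cube_le[of K] \<open>2 ^ K \<le> P\<close> by simp
  finally have 1: "K * K * (k + 2) \<le> 8 * P" .
  have 2: "k + 1 \<le> P" using K(1) \<open>2 ^ K \<le> P\<close> less_exp[of K] by linarith
  have "P * 1 \<le> P * (d * b)"
    using b1 assms(3) by (intro mult_le_mono2) (simp add: Suc_leI)
  then have 3: "P \<le> P * d * b" by (simp add: mult.assoc)
  have "P * (K * K * (d + 1)) \<le> P * (4 * b * (2 * d))"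
    using assms(3) by (intro mult_le_mono2 mult_le_mono[OF b]) simp
  then have 4: "P * (K * K * (d + 1)) \<le> 8 * (P * d * b)" by (simp add: mult_ac)
  \<comment> \<open>The constants add up to \<open>8 * 1000 + 50 + 8 * 3000 = 32050\<close>.\<close>
  have "50 * (k + 1) + 1000 * (K * K * (k + 2)) + 3000 * (P * (K * K * (d + 1))) \<le> 33000 * (P * d * b)"
  proof -
    have "50 * a + 1000 * x + 3000 * y \<le> 33000 * z"
      if "x \<le> 8 * p" "a \<le> p" "p \<le> z" "y \<le> 8 * z" for a x y z p :: nat
      using that by linarith
    from this[OF 1 2 3 4] show ?thesis .
  qed
  then show ?thesis by (simp add: K_def P_def b_def mult.assoc)
qed

lemma choose_two_mono: "a \<le> b \<Longrightarrow> a choose 2 \<le> b choose 2"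
  by (auto simp: choose_two intro!: div_le_mono mult_le_mono)

lemma outputs_within_wp:
  assumes "wp w c (\<lambda>t s'. t + 2 \<le> u \<and> fst s' 0 = v) (start w)"
  shows "outputs_within (compile c) w u v"
  using assms outputs_within_compile unfolding wp_def by blast

lemma outputs_within_mono:
  assumes "outputs_within P w t v" "t \<le> u"
  shows "outputs_within P w u v"
  using assms run_halted[of P "init w" t _ u] by (simp add: outputs_within_def run_def Let_def)

text \<open>The procedure only sees the \<open>?k\<close> occurring existential variables; with at
  least two clauses the search term grows monotonically from \<open>?k\<close> to \<open>k\<close>.
  In the degenerate cases the term \<open>2 ^ k * matrix_size \<Phi>\<close> alone pays. The factor
  40000 exceeds both 33000 and \<open>300 + 2\<close>.\<close>

lemma outputs_within_decide:
  assumes wf: "wf_qcnf \<Phi>" and d: "\<forall>C \<in> set (matrix \<Phi>). length C \<le> d"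
  defines "k \<equiv> num_existential \<Phi>"
  shows "outputs_within (compile decide) (enc_qcnf \<Phi>)
    (40000 * (length (matrix \<Phi>) ^ (2 ^ k) * d * ((2 ^ k) choose 2) + 2 ^ k * matrix_size \<Phi>))
    (of_bool (qcnf_true \<Phi>))"
proof -
  interpret formula \<Phi> by unfold_locales (rule wf)
  let ?k = "card (occurring \<Phi>)"
  let ?b = "\<lambda>k. m ^ (2 ^ k) * d * ((2 ^ k) choose 2)"
  have kk: "(2 :: nat) ^ ?k \<le> 2 ^ k"
    using card_occurring[of \<Phi>] by (simp add: k_def)
  have size: "1 \<le> matrix_size \<Phi>" "1 * matrix_size \<Phi> \<le> 2 ^ k * matrix_size \<Phi>"
    by (simp add: matrix_size_def enc_matrix_def) (rule mult_le_mono1, simp)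
  have mono: "?b ?k \<le> ?b k" if "2 \<le> m"
    using that kk by (intro mult_le_mono power_increasing choose_two_mono) auto
  have d0: "0 < d" if "0 < ?k"
  proof -
    have "occurring \<Phi> \<noteq> {}" using that by auto
    then obtain v where "v \<in> occurring \<Phi>" by blast
    then obtain D l where "D \<in> set (matrix \<Phi>)" "l \<in> set D" unfolding occurring_def by blast
    then have "0 < length D" "length D \<le> d" using d by (auto simp: length_pos_if_in_set)
    then show ?thesis by (rule less_le_trans)
  qed
  let ?B = "if 2 \<le> m \<and> 0 < ?k then
      50 * (?k + 1) + 1000 * 2 ^ ?k * 2 ^ ?k * (?k + 2) +
        3000 * (m ^ 2 ^ ?k * (2 ^ ?k * 2 ^ ?k * (d + 1))) else 0"
  have B: "?B \<le> 33000 * ?b k"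
    using le_trans[OF time_bound mult_le_mono2[OF mono]] d0 by simp
  show ?thesis
  proof (rule outputs_within_wp, rule wp_mono[OF wp_decide[OF d]], elim conjE, intro conjI)
    fix t assume t: "t \<le> 300 * matrix_size \<Phi> + ?B"
    have "t + 2 \<le> 40000 * (x + y)" if "t \<le> 300 * s + b" "b \<le> 33000 * x" "1 \<le> s" "1 * s \<le> y"
      for b s x y :: nat using that by simp
    from this[OF t B size] show "t + 2 \<le> 40000 * (?b k + 2 ^ k * matrix_size \<Phi>)" .
  qed
qed

text \<open>The exponent \<open>32 * 2 ^ k\<close> used for XP is itself a power of two, so
  \<open>power_of_two\<close> computes it.\<close>

lemma computable_exponent: "computable (\<lambda>k. 2 ^ (k + 5))"
  unfolding computable_def
proof (intro exI allI)
  fix k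
  let ?c = "Read x_k (Num 0) ;; Incr x_k 5 ;; power_of_two ;; Assign x_res (Var x_K)"
  show "outputs_within (compile ?c) [k] (50 * (k + 10)) (2 ^ (k + 5))"
    apply (rule outputs_within_wp)
    apply (simp add: wp_Seq start_def)
    apply (rule wp_mono[OF wp_power_of_two])
    apply simp
    done
qed

theorem theorem10:
  "in_XP {\<Phi>. wf_qcnf \<Phi>} enc_qcnf qcnf_true num_existential \<and>
   (\<exists>(P :: instr list) (c :: nat). \<forall>\<Phi> k m d.
      wf_qcnf \<Phi> \<longrightarrow> num_existential \<Phi> = k \<longrightarrow> length (matrix \<Phi>) = m \<longrightarrow>
      (\<forall>C \<in> set (matrix \<Phi>). length C \<le> d) \<longrightarrow>
      outputs_within P (enc_qcnf \<Phi>)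
        (c * (m ^ (2 ^ k) * d * ((2 ^ k) choose 2) + 2 ^ k * matrix_size \<Phi>))
        (of_bool (qcnf_true \<Phi>)))"
proof
  have "outputs_within (compile decide) (enc_qcnf \<Phi>)
      (length (enc_qcnf \<Phi>) ^ 2 ^ (num_existential \<Phi> + 5)) (of_bool (qcnf_true \<Phi>))"
    if wf: "wf_qcnf \<Phi>" for \<Phi>
  proof -
    interpret formula \<Phi> by unfold_locales (rule wf)
    define N where "N = length w"
    define k where "k = num_existential \<Phi>"
    define K :: nat where "K = 2 ^ k"
    have size: "matrix_size \<Phi> \<le> N" "2 \<le> N"
      by (simp_all add: N_def enc_qcnf_def matrix_size_def enc_matrix_def)
    have len: "m + (\<Sum>i<m. 2 * length (C i)) < N"
      using size(1) length_enc_clauses[of m]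
      by (simp add: matrix_size_def enc_matrix_def sum_Suc)
    \<comment> \<open>Each literal takes two words, so the encoding length \<open>N\<close> can
      serve as the bound on clause sizes.\<close>
    have d: "\<forall>D \<in> set (matrix \<Phi>). length D \<le> N"
    proof
      fix D assume "D \<in> set (matrix \<Phi>)"
      then obtain i where i: "i < m" "D = C i" by (auto simp: in_set_conv_nth)
      then have "2 * length (C i) \<le> (\<Sum>i<m. 2 * length (C i))" by (intro member_le_sum) auto
      then show "length D \<le> N" using len i by simp
    qed
    have K1: "1 \<le> K" "k + 1 \<le> K" by (simp_all add: K_def Suc_leI)
    have KN: "K \<le> N ^ k" unfolding K_def using size(2) by (rule power_mono) simp
    have "K choose 2 \<le> K * K" using K1 by (simp add: choose_two) (metis diff_le_self div_le_dividend le_trans mult_le_mono2)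
    also have "\<dots> \<le> N ^ k * N ^ k" using KN by (intro mult_le_mono)
    finally have "m ^ K * N * (K choose 2) \<le> N ^ K * N * (N ^ k * N ^ k)"
      using len by (intro mult_le_mono power_mono) auto
    also have "\<dots> = N ^ (K + 2 * k + 1)" by (simp add: power_add mult_2)
    finally have 1: "m ^ K * N * (K choose 2) \<le> N ^ (K + 2 * k + 1)" .
    have "K * matrix_size \<Phi> \<le> N ^ k * N" using KN size(1) by (rule mult_le_mono)
    also have "\<dots> = N ^ (k + 1)" by simp
    also have "\<dots> \<le> N ^ (K + 2 * k + 1)" using size(2) by (intro power_increasing) auto
    finally have 2: "K * matrix_size \<Phi> \<le> N ^ (K + 2 * k + 1)" .
    \<comment> \<open>The constant factor moves into the exponent because \<open>2 \<le> N\<close>;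
      \<open>2 ^ 17\<close> is the least power of two above 80000.\<close>
    have "(40000 :: nat) * 2 \<le> 2 ^ 17" by simp
    also have "\<dots> \<le> N ^ 17" using size(2) by (rule power_mono) simp
    finally have 3: "40000 * 2 \<le> N ^ 17" .
    have "m ^ K * N * (K choose 2) + K * matrix_size \<Phi> \<le> 2 * N ^ (K + 2 * k + 1)"
      using add_mono[OF 1 2] by (simp only: mult_2)
    then have "40000 * (m ^ K * N * (K choose 2) + K * matrix_size \<Phi>) \<le>
        40000 * 2 * N ^ (K + 2 * k + 1)"
      unfolding mult.assoc[of 40000 2] by (rule mult_le_mono2)
    also have "\<dots> \<le> N ^ 17 * N ^ (K + 2 * k + 1)" using 3 by (rule mult_le_mono1)
    also have "\<dots> = N ^ (17 + (K + 2 * k + 1))" by (simp only: power_add)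
    \<comment> \<open>\<open>K + 2 * k + 18 \<le> 19 * K\<close> because
      \<open>k + 1 \<le> K\<close>; 32 is the next power of two, which makes the exponent
      \<open>2 ^ (k + 5)\<close>.\<close>
    also have "\<dots> \<le> N ^ (32 * K)" using size(2) K1 by (intro power_increasing) auto
    also have "32 * K = 2 ^ (k + 5)" by (simp add: K_def power_add)
    finally have t: "40000 * (m ^ K * N * (K choose 2) + K * matrix_size \<Phi>) \<le> N ^ 2 ^ (k + 5)" .
    have "outputs_within (compile decide) w
        (40000 * (m ^ K * N * (K choose 2) + K * matrix_size \<Phi>)) (of_bool (qcnf_true \<Phi>))"
      unfolding K_def k_def by (rule outputs_within_decide[OF wf d])
    from outputs_within_mono[OF this t] show ?thesis by (simp only: N_def k_def)
  qed
  then show "in_XP {\<Phi>. wf_qcnf \<Phi>} enc_qcnf qcnf_true num_existential"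
    unfolding in_XP_def using computable_exponent by blast
next
  show "\<exists>(P :: instr list) (c :: nat). \<forall>\<Phi> k m d.
      wf_qcnf \<Phi> \<longrightarrow> num_existential \<Phi> = k \<longrightarrow> length (matrix \<Phi>) = m \<longrightarrow>
      (\<forall>C \<in> set (matrix \<Phi>). length C \<le> d) \<longrightarrow>
      outputs_within P (enc_qcnf \<Phi>)
        (c * (m ^ (2 ^ k) * d * ((2 ^ k) choose 2) + 2 ^ k * matrix_size \<Phi>))
        (of_bool (qcnf_true \<Phi>))"
    using outputs_within_decide by blast
qed

end
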